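(* Let $\Phi$ be a linear random dynamical system on $\mathbb{R}^d$ with time set $\mathbb{T}\in\{\mathbb{Z},\mathbb{R}\}$ over $\theta$. Let $H:\Omega\to\mathrm{GL}(d,\mathbb{R})$ be measurable and such that $\mathbb{T}\to\mathrm{GL}(d,\mathbb{R})$, $t\mapsto H(\theta_t\omega)$, is continuous for every $\omega\in\Omega$. Suppose further that the random variables $\omega\mapsto\|H(\omega)^{\pm1}\|$ are tempered, i.e. $$\lim_{t\to\pm\infty}\frac1{|t|}\ln\|H(\theta_t\omega)^{\pm1}\|=0\quad\text{almost surely}.$$ Then the weak Morse spectrum $\Xi_\Psi$ of the linear random dynamical system $$\Psi(t,\omega):=H(\theta_t\omega)\Phi(t,\omega)H^{-1}(\omega)$$ agrees almost surely with the weak Morse spectrum $\Xi_\Phi$ of $\Phi$.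
   Context: Setting. $(\Omega,\mathcal{F},\mu)$ is a complete probability space, $\mathbb{T}=\mathbb{Z}$ or $\mathbb{T}=\mathbb{R}$, and $\theta:\mathbb{T}\times\Omega\to\Omega$, $(t,\omega)\mapsto\theta_t\omega$, is a (measurable) $\mu$-preserving ergodic dynamical system. If $\mathbb{T}=\mathbb{R}$, $\Omega$ is also a metric space and $t\mapsto\theta_t\omega$ is continuous for every $\omega$. A linear random dynamical system on $\mathbb{R}^d$ is a map $\Phi:\mathbb{T}\times\Omega\to\mathbb{R}^{d\times d}$ such that $(t,\omega,x)\mapsto\Phi(t,\omega)x$ is measurable, $\Phi(0,\omega)=\mathrm{Id}$, $\Phi(t+s,\omega)=\Phi(t,\theta_s\omega)\Phi(s,\omega)$ for all $t,s,\omega$, and $(t,x)\mapsto\Phi(t,\omega)x$ is continuous for each $\omega$ (so each $\Phi(t,\omega)$ is invertible). $\|\cdot\|$ is the Euclidean norm and the induced operator norm. Projective space. $\mathbb{P}^{d-1}$ is real projective space, $\mathbb{P}x$ is the class of $x\ne0$, with metric $d_{\mathbb{P}}(\mathbb{P}x,\mathbb{P}y)=\min\{|\frac{x}{\|x\|}-\frac{y}{\|y\|}|,|\frac{x}{\|x\|}+\frac{y}{\|y\|}|\}$; $\mathbb{P}\Phi(t,\omega)\mathbb{P}x:=\mathbb{P}(\Phi(t,\omega)x)$. For $A\subset\mathbb{P}^{d-1}$, $\mathbb{P}^{-1}A:=\{x\neq0:\mathbb{P}x\in A\}\cup\{0\}$. Random sets. Let $X=\mathbb{P}^{d-1}$ and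 $\varphi=\mathbb{P}\Phi$. A random set is a set $D\in\mathcal{B}(X)\otimes\mathcal{F}$, with fibres $D(\omega)=\{x:(x,\omega)\in D\}$; it is closed/open/compact if every fibre is. It is forward (backward) invariant if $\varphi(t,\omega)D(\omega)\subseteq D(\theta_t\omega)$ for all $\omega$ and all $t\ge0$ ($t\le0$), and invariant if $\varphi(t,\omega)D(\omega)=D(\theta_t\omega)$ for all $\omega$ and $t\in\mathbb{T}$. Put $\operatorname{dist}(A,B)=\sup_{a\in A}\inf_{b\in B}d(a,b)$ for nonempty sets, $\operatorname{dist}(\emptyset,\emptyset)=\operatorname{dist}(\emptyset,A)=0$, $\operatorname{dist}(A,\emptyset)=\infty$. Attractors and repellers. An invariant compact random set $A$ is a local weak attractor if there is a forward invariant open random set $U$ with $U(\omega)\supset A(\omega)$ a.s. such that for each closed random set $C\subset U$ and every $\varepsilon>0$, $\lim_{t\to\infty}\mu\{\omega:\operatorname{dist}(\varphi(t,\omega)C(\omega),A(\theta_t\omega))>\varepsilon\}=0$. Its basin is $B(A)(\omega)=\{x\in X:\varphi(t,\omega)x\in U(\theta_t\omega)\text{ for some }t\ge0\}$ (independent of $U$ up to null sets). A local weak repeller is defined analogously with backward invariant $U$ and $t\to-\infty$. For a local weak attractor $A$, $R:=X\setminus B(A)$ is a local weak repeller, and $(A,R)$ is called a weak attractor-repeller pair. Morse decompositions. If $(A_i,R_i)$, $i=0,\dots,n$, are weak attractor-repeller pairs with a.s. $\emptyset=A_0(\omega)\subsetneq A_1(\omega)\subsetneq\dots\subsetneq A_n(\omega)=X$,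 then $\{M_1,\dots,M_n\}$ with $M_i:=A_i\cap R_{i-1}$ is a weak Morse decomposition of $X$. A decomposition $\{M_1,\dots,M_n\}$ is finer than $\{\tilde M_1,\dots,\tilde M_m\}$ if for each $i\in\{1,\dots,m\}$ there is $j\in\{1,\dots,n\}$ with $M_j(\omega)\subset\tilde M_i(\omega)$ a.s.; a minimal element of this partial ordering is a finest weak Morse decomposition. It is known that the projectivisation of every linear random dynamical system has a unique (up to null sets) finest weak Morse decomposition $\{M_1,\dots,M_n\}$, that $n\le d$, and that a.s. the $\mathbb{P}^{-1}M_i(\omega)$ are linear subspaces with $\bigoplus_{i=1}^n\mathbb{P}^{-1}M_i(\omega)=\mathbb{R}^d$. Morse spectrum. For an invariant nonempty compact random set $M$ with $\mathbb{P}^{-1}M(\omega)$ a.s. a linear subspace, $\Xi(\mathbb{P}^{-1}M)(\omega)$ is the set of all $\xi\in\overline{\mathbb{R}}$ for which there is a sequence $(T_k,t_k,x_k)_{k\in\mathbb{N}}$ with $T_k,t_k\in\mathbb{T}$, $|T_k|\ge|t_k|$, $x_k\in\mathbb{P}^{-1}M(\theta_{t_k}\omega)\setminus\{0\}$, $T_k\to\infty$ and $\lambda^{T_k}(\theta_{t_k}\omega,x_k)\to\xi$, where $\lambda^T(\omega,x):=\frac1T\ln\frac{\|\Phi(T,\omega)x\|}{\|x\|}$. With $\{M_1,\dots,M_n\}$ the unique finest weak Morse decomposition, the weak Morse spectrum is $\Xi_\Phi(\omega)=\Xi_w(\omega):=\bigcup_{i=1}^n\Xi(\mathbb{P}^{-1}M_i)(\omega)$;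 $\Xi_\Psi$ is the same object formed for $\Psi$ in place of $\Phi$. *)

theory Defs
  imports "HOL-Probability.Probability"
begin

section \<open>Real projective space\<close>

definition proj_rel :: "real ^ 'd \<Rightarrow> real ^ 'd \<Rightarrow> bool" where
  "proj_rel x y \<longleftrightarrow> x \<noteq> 0 \<and> y \<noteq> 0 \<and> (\<exists>c. c \<noteq> 0 \<and> y = c *\<^sub>R x)"

lemma part_equivp_proj_rel: "part_equivp (proj_rel :: real ^ 'd::finite \<Rightarrow> _)"
proof (rule part_equivpI)
  have "proj_rel (1 :: real ^ 'd) 1"
    unfolding proj_rel_def by (auto intro: exI[of _ 1])
  then show "\<exists>x :: real ^ 'd. proj_rel x x" by blast
  show "symp (proj_rel :: real ^ 'd \<Rightarrow> _)"
  proof (rule sympI)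
    fix x y :: "real ^ 'd" assume "proj_rel x y"
    then obtain c where "x \<noteq> 0" "y \<noteq> 0" "c \<noteq> 0" "y = c *\<^sub>R x"
      unfolding proj_rel_def by blast
    then have "x = inverse c *\<^sub>R y" "inverse c \<noteq> 0" by simp_all
    then show "proj_rel y x" unfolding proj_rel_def using \<open>x \<noteq> 0\<close> \<open>y \<noteq> 0\<close> by blast
  qed
  show "transp (proj_rel :: real ^ 'd \<Rightarrow> _)"
    by (rule transpI) (auto simp: proj_rel_def)
qed

text \<open>The class \<open>\<bbbP>x\<close> of \<open>x \<noteq> 0\<close> is \<open>abs_proj x\<close>; \<open>abs_proj 0\<close> is an unspecified point.\<close>

quotient_type 'd proj = "real ^ 'd::finite" / partial: proj_rel
  by (rule part_equivp_proj_rel)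

lemma proj_rel_sgn:
  assumes "proj_rel x y"
  shows "sgn y = sgn x \<or> sgn y = - sgn x"
  using assms unfolding proj_rel_def by (auto simp: sgn_scaleR sgn_real_def)

instantiation proj :: (finite) metric_space
begin

lift_definition dist_proj :: "'a proj \<Rightarrow> 'a proj \<Rightarrow> real" is
  "\<lambda>x y. min (norm (x /\<^sub>R norm x - y /\<^sub>R norm y)) (norm (x /\<^sub>R norm x + y /\<^sub>R norm y))"
proof -
  fix x x' y y' :: "real ^ 'a"
  assume "proj_rel x x'" "proj_rel y y'"
  then have "sgn x' = sgn x \<or> sgn x' = - sgn x" "sgn y' = sgn y \<or> sgn y' = - sgn y"
    by (simp_all add: proj_rel_sgn)
  moreover have "norm (- sgn x - sgn y) = norm (sgn x + sgn y)"
    by (metis minus_add_distrib norm_minus_cancel uminus_add_conv_diff diff_conv_add_uminus)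
  moreover have "norm (- sgn x + sgn y) = norm (sgn x - sgn y)"
    by (metis add.commute norm_minus_commute uminus_add_conv_diff)
  ultimately have "min (norm (sgn x - sgn y)) (norm (sgn x + sgn y)) =
      min (norm (sgn x' - sgn y')) (norm (sgn x' + sgn y'))"
    by (auto simp: min.commute norm_minus_commute)
  then show "min (norm (x /\<^sub>R norm x - y /\<^sub>R norm y)) (norm (x /\<^sub>R norm x + y /\<^sub>R norm y)) =
      min (norm (x' /\<^sub>R norm x' - y' /\<^sub>R norm y')) (norm (x' /\<^sub>R norm x' + y' /\<^sub>R norm y'))"
    by (simp add: sgn_div_norm)
qed

definition uniformity_proj :: "('a proj \<times> 'a proj) filter" where
  "uniformity_proj = (INF e\<in>{0 <..}. principal {(x, y). dist x y < e})"

definition open_proj :: "'a proj set \<Rightarrow> bool" where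
  "open_proj U \<longleftrightarrow> (\<forall>x\<in>U. eventually (\<lambda>(x', y). x' = x \<longrightarrow> y \<in> U) uniformity)"

instance
proof
  fix p q r :: "'a proj"
  show "dist p q = 0 \<longleftrightarrow> p = q"
  proof transfer
    fix x y :: "real ^ 'a"
    assume xy: "proj_rel x x" "proj_rel y y"
    then have nz: "x \<noteq> 0" "y \<noteq> 0" by (auto simp: proj_rel_def)
    have "min (norm (sgn x - sgn y)) (norm (sgn x + sgn y)) = 0 \<longleftrightarrow> proj_rel x y"
    proof
      assume "min (norm (sgn x - sgn y)) (norm (sgn x + sgn y)) = 0"
      then have "sgn x - sgn y = 0 \<or> sgn x + sgn y = 0"
        by (metis min_def norm_eq_zero)
      then obtain s :: real where s: "s \<noteq> 0" "sgn y = s *\<^sub>R sgn x"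
      proof
        assume "sgn x - sgn y = 0"
        then show thesis using that[of 1] by simp
      next
        assume "sgn x + sgn y = 0"
        then show thesis using that[of "-1"] by (simp add: add_eq_0_iff)
      qed
      have "y = norm y *\<^sub>R sgn y" using nz by (simp add: sgn_div_norm)
      also have "\<dots> = (norm y * s / norm x) *\<^sub>R x"
        using s by (simp add: sgn_div_norm divide_inverse)
      finally have "y = (norm y * s / norm x) *\<^sub>R x" .
      moreover have "norm y * s / norm x \<noteq> 0" using s nz by simp
      ultimately show "proj_rel x y" unfolding proj_rel_def using nz by blast
    next
      assume "proj_rel x y"
      then have "sgn y = sgn x \<or> sgn y = - sgn x" by (rule proj_rel_sgn)
      then show "min (norm (sgn x - sgn y)) (norm (sgn x + sgn y)) = 0" by auto
    qed
    then show "min (norm (x /\<^sub>R norm x - y /\<^sub>R norm y)) (norm (x /\<^sub>R norm x + y /\<^sub>R norm y)) = 0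
        \<longleftrightarrow> proj_rel x y"
      by (simp add: sgn_div_norm)
  qed
  show "dist p q \<le> dist p r + dist q r"
  proof transfer
    fix x y z :: "real ^ 'a"
    have *: "min (norm (u - v)) (norm (u + v)) \<le>
        min (norm (u - w)) (norm (u + w)) + min (norm (v - w)) (norm (v + w))"
      for u v w :: "real ^ 'a"
    proof -
      have "norm (u - v) \<le> norm (u - w) + norm (v - w)"
        by (rule norm_diff_triangle_ineq[of u w w v, simplified norm_minus_commute[of w v], THEN order_trans[rotated]])
          simp
      moreover have "norm (u - v) \<le> norm (u + w) + norm (v + w)"
        using norm_triangle_ineq4[of "u + w" "v + w"] by simp
      moreover have "norm (u + v) \<le> norm (u - w) + norm (v + w)"
        using norm_triangle_ineq[of "u - w" "v + w"] by simp
      moreover have "norm (u + v) \<le> norm (u + w) + norm (v - w)"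
        using norm_triangle_ineq[of "u + w" "v - w"] by simp
      ultimately show ?thesis by linarith
    qed
    show "min (norm (x /\<^sub>R norm x - y /\<^sub>R norm y)) (norm (x /\<^sub>R norm x + y /\<^sub>R norm y))
      \<le> min (norm (x /\<^sub>R norm x - z /\<^sub>R norm z)) (norm (x /\<^sub>R norm x + z /\<^sub>R norm z))
        + min (norm (y /\<^sub>R norm y - z /\<^sub>R norm z)) (norm (y /\<^sub>R norm y + z /\<^sub>R norm z))"
      by (rule *)
  qed
qed (simp_all add: uniformity_proj_def open_proj_def)

end

definition proj_map :: "real ^ 'd ^ 'd \<Rightarrow> 'd::finite proj \<Rightarrow> 'd proj" where
  "proj_map A p = abs_proj (A *v rep_proj p)"

lemma proj_map_abs_proj:
  assumes "invertible A" "x \<noteq> 0"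
  shows "proj_map A (abs_proj x) = abs_proj (A *v x)"
proof -
  have "proj_rel x x" using assms unfolding proj_rel_def by (auto intro: exI[of _ 1])
  then have "proj_rel (rep_proj (abs_proj x)) x"
    by (metis Quotient_proj Quotient_rep_abs)
  then obtain c where c: "c \<noteq> 0" "x = c *\<^sub>R rep_proj (abs_proj x)" and nz: "rep_proj (abs_proj x) \<noteq> 0"
    unfolding proj_rel_def by blast
  have inj: "A *v v \<noteq> 0" if "v \<noteq> 0" for v
    using assms(1) that by (metis invertible_left_inverse matrix_left_invertible_ker)
  have "A *v x = c *\<^sub>R (A *v rep_proj (abs_proj x))"
    using c(2) by (metis matrix_vector_mult_scaleR)
  then have "proj_rel (A *v rep_proj (abs_proj x)) (A *v x)"
    unfolding proj_rel_def using inj nz assms(2) c(1) by blast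
  then show ?thesis
    unfolding proj_map_def by (metis Quotient_proj Quotient_rel_abs)
qed

definition proj_preimage :: "'d::finite proj set \<Rightarrow> (real ^ 'd) set" where
  "proj_preimage A = {x. x \<noteq> 0 \<and> abs_proj x \<in> A} \<union> {0}"


section \<open>Base flow and linear random dynamical systems\<close>

text \<open>
  The time set is a subset \<open>T\<close> of the reals, either \<open>\<int>\<close> or all of \<open>\<real>\<close>, with the subspace
  topology and trace \<open>\<sigma>\<close>-algebra; maps on \<open>T\<close> are only constrained on \<open>T\<close>.  The sample space
  is \<open>space M\<close>.

  Completeness of \<open>M\<close> is essentially incompatible with joint measurability of a continuous-time
  flow with respect to \<open>\<B>(\<real>) \<otimes> sets M\<close>.  Joint measurability is therefore
  required, as usual, for some \<open>\<sigma>\<close>-algebra \<open>sets N\<close> of which \<open>M\<close> is the completion; the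
  choice \<open>N = M\<close> is allowed.  The metric \<open>d\<close> on the sample space only matters for \<open>T = UNIV\<close>.
\<close>

definition ergodic_flow ::
    "'w measure \<Rightarrow> real set \<Rightarrow> ('w \<Rightarrow> 'w \<Rightarrow> real) \<Rightarrow> (real \<Rightarrow> 'w \<Rightarrow> 'w) \<Rightarrow> bool" where
  "ergodic_flow M T d \<theta> \<longleftrightarrow>
     prob_space M \<and> complete_measure M \<and> (T = \<int> \<or> T = UNIV) \<and>
     (\<exists>N. completion N = M \<and>
        (\<lambda>(t, \<omega>). \<theta> t \<omega>) \<in> restrict_space borel T \<Otimes>\<^sub>M N \<rightarrow>\<^sub>M N) \<and>
     (\<forall>\<omega>\<in>space M. \<theta> 0 \<omega> = \<omega>) \<and>
     (\<forall>t\<in>T. \<forall>s\<in>T. \<forall>\<omega>\<in>space M. \<theta> (t + s) \<omega> = \<theta> t (\<theta> s \<omega>)) \<and>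
     (\<forall>t\<in>T. \<theta> t \<in> M \<rightarrow>\<^sub>M M \<and> distr M M (\<theta> t) = M) \<and>
     (\<forall>A\<in>sets M. (\<forall>t\<in>T. \<theta> t -` A \<inter> space M = A) \<longrightarrow> measure M A = 0 \<or> measure M A = 1) \<and>
     (T = UNIV \<longrightarrow> Metric_space (space M) d \<and>
        (\<forall>\<omega>\<in>space M. continuous_map euclideanreal (Metric_space.mtopology (space M) d) (\<lambda>t. \<theta> t \<omega>)))"

definition linear_rds ::
    "'w measure \<Rightarrow> real set \<Rightarrow> (real \<Rightarrow> 'w \<Rightarrow> 'w) \<Rightarrow> (real \<Rightarrow> 'w \<Rightarrow> real ^ 'd ^ 'd) \<Rightarrow> bool" where
  "linear_rds M T \<theta> \<Phi> \<longleftrightarrow>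
     (\<lambda>(t, \<omega>, x). \<Phi> t \<omega> *v x) \<in> borel_measurable (restrict_space borel T \<Otimes>\<^sub>M M \<Otimes>\<^sub>M borel) \<and>
     (\<forall>\<omega>\<in>space M. \<Phi> 0 \<omega> = mat 1) \<and>
     (\<forall>t\<in>T. \<forall>s\<in>T. \<forall>\<omega>\<in>space M. \<Phi> (t + s) \<omega> = \<Phi> t (\<theta> s \<omega>) ** \<Phi> s \<omega>) \<and>
     (\<forall>\<omega>\<in>space M. continuous_on (T \<times> UNIV) (\<lambda>(t, x). \<Phi> t \<omega> *v x))"

definition projectivisation ::
    "(real \<Rightarrow> 'w \<Rightarrow> real ^ 'd ^ 'd) \<Rightarrow> real \<Rightarrow> 'w \<Rightarrow> 'd::finite proj \<Rightarrow> 'd proj" where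
  "projectivisation \<Phi> t \<omega> = proj_map (\<Phi> t \<omega>)"


section \<open>Random sets and attractor-repeller pairs\<close>

text \<open>A random set is represented by its fibre map.\<close>

definition random_set :: "'w measure \<Rightarrow> ('w \<Rightarrow> 'x::topological_space set) \<Rightarrow> bool" where
  "random_set M D \<longleftrightarrow> {(x, \<omega>). \<omega> \<in> space M \<and> x \<in> D \<omega>} \<in> sets (borel \<Otimes>\<^sub>M M)"

definition open_random_set :: "'w measure \<Rightarrow> ('w \<Rightarrow> 'x::topological_space set) \<Rightarrow> bool" where
  "open_random_set M D \<longleftrightarrow> random_set M D \<and> (\<forall>\<omega>\<in>space M. open (D \<omega>))"

definition closed_random_set :: "'w measure \<Rightarrow> ('w \<Rightarrow> 'x::topological_space set) \<Rightarrow> bool" where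
  "closed_random_set M D \<longleftrightarrow> random_set M D \<and> (\<forall>\<omega>\<in>space M. closed (D \<omega>))"

definition compact_random_set :: "'w measure \<Rightarrow> ('w \<Rightarrow> 'x::topological_space set) \<Rightarrow> bool" where
  "compact_random_set M D \<longleftrightarrow> random_set M D \<and> (\<forall>\<omega>\<in>space M. compact (D \<omega>))"

definition forward_invariant ::
    "'w measure \<Rightarrow> real set \<Rightarrow> (real \<Rightarrow> 'w \<Rightarrow> 'w) \<Rightarrow> (real \<Rightarrow> 'w \<Rightarrow> 'x \<Rightarrow> 'x) \<Rightarrow> ('w \<Rightarrow> 'x set) \<Rightarrow> bool"
  where "forward_invariant M T \<theta> \<phi> D \<longleftrightarrow>
     (\<forall>\<omega>\<in>space M. \<forall>t\<in>T. t \<ge> 0 \<longrightarrow> \<phi> t \<omega> ` D \<omega> \<subseteq> D (\<theta> t \<omega>))"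

definition invariant ::
    "'w measure \<Rightarrow> real set \<Rightarrow> (real \<Rightarrow> 'w \<Rightarrow> 'w) \<Rightarrow> (real \<Rightarrow> 'w \<Rightarrow> 'x \<Rightarrow> 'x) \<Rightarrow> ('w \<Rightarrow> 'x set) \<Rightarrow> bool"
  where "invariant M T \<theta> \<phi> D \<longleftrightarrow> (\<forall>\<omega>\<in>space M. \<forall>t\<in>T. \<phi> t \<omega> ` D \<omega> = D (\<theta> t \<omega>))"

definition semi_dist :: "'x::metric_space set \<Rightarrow> 'x set \<Rightarrow> ereal" where
  "semi_dist A B =
     (if A = {} then 0 else if B = {} then \<infinity> else (SUP a\<in>A. INF b\<in>B. ereal (dist a b)))"

text \<open>
  The exceptional set below is measurable by the projection theorem, since \<open>M\<close> is complete, so its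
  outer measure is its measure.  Using the outer measure avoids building that theorem into the
  definition (\<open>measure M\<close> has the junk value 0 on sets not yet known to be measurable).
\<close>

definition attracting_nbhd ::
    "'w measure \<Rightarrow> real set \<Rightarrow> (real \<Rightarrow> 'w \<Rightarrow> 'w) \<Rightarrow> (real \<Rightarrow> 'w \<Rightarrow> 'x \<Rightarrow> 'x) \<Rightarrow>
     ('w \<Rightarrow> 'x::metric_space set) \<Rightarrow> ('w \<Rightarrow> 'x set) \<Rightarrow> bool"
  where "attracting_nbhd M T \<theta> \<phi> A U \<longleftrightarrow>
     open_random_set M U \<and> forward_invariant M T \<theta> \<phi> U \<and>
     (AE \<omega> in M. A \<omega> \<subseteq> U \<omega>) \<and>
     (\<forall>C. closed_random_set M C \<and> (\<forall>\<omega>\<in>space M. C \<omega> \<subseteq> U \<omega>) \<longrightarrow>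
        (\<forall>\<epsilon>::real. \<epsilon> > 0 \<longrightarrow>
          ((\<lambda>t. outer_measure_of M
                {\<omega> \<in> space M. semi_dist (\<phi> t \<omega> ` C \<omega>) (A (\<theta> t \<omega>)) > ereal \<epsilon>}) \<longlongrightarrow> 0)
            (inf at_top (principal T))))"

definition local_weak_attractor ::
    "'w measure \<Rightarrow> real set \<Rightarrow> (real \<Rightarrow> 'w \<Rightarrow> 'w) \<Rightarrow> (real \<Rightarrow> 'w \<Rightarrow> 'x \<Rightarrow> 'x) \<Rightarrow>
     ('w \<Rightarrow> 'x::metric_space set) \<Rightarrow> bool"
  where "local_weak_attractor M T \<theta> \<phi> A \<longleftrightarrow>
     compact_random_set M A \<and> invariant M T \<theta> \<phi> A \<and> (\<exists>U. attracting_nbhd M T \<theta> \<phi> A U)"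

definition basin ::
    "real set \<Rightarrow> (real \<Rightarrow> 'w \<Rightarrow> 'w) \<Rightarrow> (real \<Rightarrow> 'w \<Rightarrow> 'x \<Rightarrow> 'x) \<Rightarrow> ('w \<Rightarrow> 'x set) \<Rightarrow> 'w \<Rightarrow> 'x set"
  where "basin T \<theta> \<phi> U \<omega> = {x. \<exists>t\<in>T. t \<ge> 0 \<and> \<phi> t \<omega> x \<in> U (\<theta> t \<omega>)}"

text \<open>
  The basin depends on the choice of \<open>U\<close> only up to null sets; any admissible \<open>U\<close> may be used.
\<close>

definition weak_attractor_repeller_pair ::
    "'w measure \<Rightarrow> real set \<Rightarrow> (real \<Rightarrow> 'w \<Rightarrow> 'w) \<Rightarrow> (real \<Rightarrow> 'w \<Rightarrow> 'x \<Rightarrow> 'x) \<Rightarrow>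
     ('w \<Rightarrow> 'x::metric_space set) \<Rightarrow> ('w \<Rightarrow> 'x set) \<Rightarrow> bool"
  where "weak_attractor_repeller_pair M T \<theta> \<phi> A R \<longleftrightarrow>
     local_weak_attractor M T \<theta> \<phi> A \<and>
     (\<exists>U. attracting_nbhd M T \<theta> \<phi> A U \<and> (\<forall>\<omega>\<in>space M. R \<omega> = UNIV - basin T \<theta> \<phi> U \<omega>))"


section \<open>Weak Morse decompositions and the weak Morse spectrum\<close>

definition weak_Morse_decomposition ::
    "'w measure \<Rightarrow> real set \<Rightarrow> (real \<Rightarrow> 'w \<Rightarrow> 'w) \<Rightarrow> (real \<Rightarrow> 'w \<Rightarrow> 'x \<Rightarrow> 'x) \<Rightarrow>
     ('w \<Rightarrow> 'x::metric_space set) set \<Rightarrow> bool"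
  where "weak_Morse_decomposition M T \<theta> \<phi> \<M> \<longleftrightarrow>
     (\<exists>n A R. (\<forall>i\<le>n. weak_attractor_repeller_pair M T \<theta> \<phi> (A i) (R i)) \<and>
        (AE \<omega> in M. A 0 \<omega> = {} \<and> (\<forall>i<n. A i \<omega> \<subset> A (Suc i) \<omega>) \<and> A n \<omega> = UNIV) \<and>
        \<M> = (\<lambda>i \<omega>. A i \<omega> \<inter> R (i - 1) \<omega>) ` {1..n::nat})"

definition finer :: "'w measure \<Rightarrow> ('w \<Rightarrow> 'x set) set \<Rightarrow> ('w \<Rightarrow> 'x set) set \<Rightarrow> bool" where
  "finer M \<M> \<N> \<longleftrightarrow> (\<forall>N\<in>\<N>. \<exists>D\<in>\<M>. AE \<omega> in M. D \<omega> \<subseteq> N \<omega>)"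

definition finest_weak_Morse_decomposition ::
    "'w measure \<Rightarrow> real set \<Rightarrow> (real \<Rightarrow> 'w \<Rightarrow> 'w) \<Rightarrow> (real \<Rightarrow> 'w \<Rightarrow> 'x \<Rightarrow> 'x) \<Rightarrow>
     ('w \<Rightarrow> 'x::metric_space set) set \<Rightarrow> bool"
  where "finest_weak_Morse_decomposition M T \<theta> \<phi> \<M> \<longleftrightarrow>
     weak_Morse_decomposition M T \<theta> \<phi> \<M> \<and>
     (\<forall>\<N>. weak_Morse_decomposition M T \<theta> \<phi> \<N> \<and> finer M \<N> \<M> \<longrightarrow> finer M \<M> \<N>)"

definition equal_up_to_null_sets ::
    "'w measure \<Rightarrow> ('w \<Rightarrow> 'x set) set \<Rightarrow> ('w \<Rightarrow> 'x set) set \<Rightarrow> bool" where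
  "equal_up_to_null_sets M \<M> \<N> \<longleftrightarrow>
     (\<forall>D\<in>\<M>. \<exists>N\<in>\<N>. AE \<omega> in M. D \<omega> = N \<omega>) \<and> (\<forall>N\<in>\<N>. \<exists>D\<in>\<M>. AE \<omega> in M. D \<omega> = N \<omega>)"

text \<open>
  ``The'' finest decomposition, as a definite description up to null sets: being finest, and being
  the only finest one.
\<close>

definition the_finest_weak_Morse_decomposition ::
    "'w measure \<Rightarrow> real set \<Rightarrow> (real \<Rightarrow> 'w \<Rightarrow> 'w) \<Rightarrow> (real \<Rightarrow> 'w \<Rightarrow> 'x \<Rightarrow> 'x) \<Rightarrow>
     ('w \<Rightarrow> 'x::metric_space set) set \<Rightarrow> bool"
  where "the_finest_weak_Morse_decomposition M T \<theta> \<phi> \<M> \<longleftrightarrow>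
     finest_weak_Morse_decomposition M T \<theta> \<phi> \<M> \<and>
     (\<forall>\<N>. finest_weak_Morse_decomposition M T \<theta> \<phi> \<N> \<longrightarrow> equal_up_to_null_sets M \<M> \<N>)"

definition finite_time_exponent ::
    "(real \<Rightarrow> 'w \<Rightarrow> real ^ 'd ^ 'd) \<Rightarrow> real \<Rightarrow> 'w \<Rightarrow> real ^ 'd \<Rightarrow> real" where
  "finite_time_exponent \<Phi> \<tau> \<omega> x = 1 / \<tau> * ln (norm (\<Phi> \<tau> \<omega> *v x) / norm x)"

definition Morse_spectrum_of ::
    "real set \<Rightarrow> (real \<Rightarrow> 'w \<Rightarrow> 'w) \<Rightarrow> (real \<Rightarrow> 'w \<Rightarrow> real ^ 'd ^ 'd) \<Rightarrow>
     ('w \<Rightarrow> (real ^ 'd) set) \<Rightarrow> 'w \<Rightarrow> ereal set" where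
  "Morse_spectrum_of T \<theta> \<Phi> V \<omega> =
     {\<xi>. \<exists>(\<tau> :: nat \<Rightarrow> real) (t :: nat \<Rightarrow> real) x.
        (\<forall>k. \<tau> k \<in> T \<and> t k \<in> T \<and> \<bar>\<tau> k\<bar> \<ge> \<bar>t k\<bar> \<and> x k \<in> V (\<theta> (t k) \<omega>) - {0}) \<and>
        filterlim \<tau> at_top sequentially \<and>
        (\<lambda>k. ereal (finite_time_exponent \<Phi> (\<tau> k) (\<theta> (t k) \<omega>) (x k))) \<longlonglongrightarrow> \<xi>}"

text \<open>
  The finest decomposition, hence the spectrum, is determined only up to null sets, so the spectrum
  is a relation: \<open>\<Xi>\<close> is a version of the weak Morse spectrum of \<open>\<Phi>\<close>.
\<close>

definition is_weak_Morse_spectrum ::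
    "'w measure \<Rightarrow> real set \<Rightarrow> (real \<Rightarrow> 'w \<Rightarrow> 'w) \<Rightarrow> (real \<Rightarrow> 'w \<Rightarrow> real ^ 'd ^ 'd) \<Rightarrow>
     ('w \<Rightarrow> ereal set) \<Rightarrow> bool" where
  "is_weak_Morse_spectrum M T \<theta> \<Phi> \<Xi> \<longleftrightarrow>
     (\<exists>\<M>. the_finest_weak_Morse_decomposition M T \<theta> (projectivisation \<Phi>) \<M> \<and>
        (\<forall>\<omega>\<in>space M. \<Xi> \<omega> = (\<Union>D\<in>\<M>. Morse_spectrum_of T \<theta> \<Phi> (\<lambda>\<omega>'. proj_preimage (D \<omega>')) \<omega>)))"


section \<open>Conjugation by a tempered random matrix\<close>

definition tempered ::
    "'w measure \<Rightarrow> real set \<Rightarrow> (real \<Rightarrow> 'w \<Rightarrow> 'w) \<Rightarrow> ('w \<Rightarrow> real) \<Rightarrow> bool" where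
  "tempered M T \<theta> f \<longleftrightarrow>
     (AE \<omega> in M.
        ((\<lambda>t. 1 / \<bar>t\<bar> * ln (f (\<theta> t \<omega>))) \<longlongrightarrow> 0) (inf at_top (principal T)) \<and>
        ((\<lambda>t. 1 / \<bar>t\<bar> * ln (f (\<theta> t \<omega>))) \<longlongrightarrow> 0) (inf at_bot (principal T)))"

definition conjugate_system ::
    "(real \<Rightarrow> 'w \<Rightarrow> 'w) \<Rightarrow> ('w \<Rightarrow> real ^ 'd ^ 'd) \<Rightarrow> (real \<Rightarrow> 'w \<Rightarrow> real ^ 'd ^ 'd) \<Rightarrow>
     real \<Rightarrow> 'w \<Rightarrow> real ^ 'd ^ 'd" where
  "conjugate_system \<theta> H \<Phi> t \<omega> = H (\<theta> t \<omega>) ** \<Phi> t \<omega> ** matrix_inv (H \<omega>)"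

end

theory Submission
  imports Defs
begin

text \<open>
  Two things have to be compared along the conjugacy \<open>H\<close>: the finest weak Morse decompositions of
  \<open>\<bbbP>\<Phi>\<close> and \<open>\<bbbP>\<Psi>\<close>, and the finite-time exponents of \<open>\<Phi>\<close> and \<open>\<Psi>\<close> on them.

  For the decompositions, \<open>\<bbbP>H(\<omega>)\<close> is a random homeomorphism of projective space which is
  bi-Lipschitz with the random constant \<open>L(\<omega>) = 2 \<parallel>H(\<omega>)\<parallel> \<parallel>H(\<omega>)\<inverse>\<parallel>\<close>. Attraction is only required
  in probability, and the law of \<open>L(\<theta>\<^sub>t\<omega>)\<close> does not depend on \<open>t\<close>; hence, for each \<open>t\<close> and off an event of
  arbitrarily small probability, \<open>\<bbbP>H(\<theta>\<^sub>t\<omega>)\<close> expands distances by at most a constant independent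
  of \<open>t\<close>, and weak attraction is transported (\<open>attraction_fibre_image\<close>). Everything else in the
  definition of a weak Morse decomposition is topological or order-theoretic, so \<open>\<bbbP>H\<close> carries
  finest decompositions of \<open>\<bbbP>\<Phi>\<close> to finest decompositions of \<open>\<bbbP>\<Psi>\<close>
  (\<open>finest_weak_Morse_decomposition_fibre_image\<close>), and uniqueness identifies the image with the
  given decomposition of \<open>\<bbbP>\<Psi>\<close>, fibrewise almost surely.

  The spectrum at \<open>\<omega>\<close> sees the fibres over the whole orbit of \<open>\<omega>\<close>, uncountable if \<open>T = \<real>\<close>. Morse
  sets are invariant (\<open>Morse_set_invariant\<close>), so equality of two of them at \<open>\<omega>\<close> propagates
  along the orbit and no uncountable union of null sets arises.

  For the exponents, the chain \<open>\<Psi>(\<tau>, \<theta>\<^sub>t\<omega>) H(\<theta>\<^sub>t\<omega>) x = H(\<theta>\<^bsub>\<tau>+t\<^esub>\<omega>) \<Phi>(\<tau>, \<theta>\<^sub>t\<omega>) x\<close> shows that the exponents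
  of \<open>x\<close> and of \<open>H(\<theta>\<^sub>t\<omega>) x\<close> differ by \<open>1/\<tau>\<close> times the logarithmic distortion of \<open>H\<close> at the times
  \<open>t\<close> and \<open>\<tau> + t\<close>. Temperedness controls this distortion at large times, and continuity of
  \<open>t \<mapsto> H(\<theta>\<^sub>t\<omega>)\<close> on bounded time intervals, so it is at most \<open>C + \<epsilon>|s|\<close> at every time \<open>s\<close>
  (\<open>tempered_imp_subexponential_distortion\<close>). Since the spectrum only admits \<open>|t| \<le> |\<tau>|\<close>, the
  difference tends to \<open>0\<close> as \<open>\<tau> \<rightarrow> \<infinity>\<close> (\<open>Morse_spectrum_of_conjugate_subset\<close>).
\<close>

section \<open>Measurability of Caratheodory functions\<close>

text \<open>
  A map that is continuous in \<open>x\<close> and measurable in \<open>\<omega>\<close> is jointly measurable: replacing \<open>x\<close> by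
  the first point of an enumerated dense set within distance \<open>1/n\<close> yields maps that are measurable
  because they depend on \<open>x\<close> through a countable case distinction, and continuity gives their
  pointwise limit. The lemma is applied to the time set and to projective space; for
  \<open>(t, \<omega>) \<mapsto> H (\<theta> t \<omega>)\<close> it avoids joint measurability of the flow with respect to the complete
  \<open>\<sigma>\<close>-algebra, which may fail.
\<close>

lemma caratheodory_measurable:
  fixes f :: "'x::metric_space \<Rightarrow> 'w \<Rightarrow> 'y::metric_space"
  assumes C: "countable C" "C \<subseteq> S" "S \<subseteq> closure C"
    and cont: "\<And>\<omega>. \<omega> \<in> space M \<Longrightarrow> continuous_on S (\<lambda>x. f x \<omega>)"
    and meas: "\<And>x. x \<in> S \<Longrightarrow> f x \<in> borel_measurable M"
  shows "(\<lambda>(x, \<omega>). f x \<omega>) \<in> borel_measurable (restrict_space borel S \<Otimes>\<^sub>M M)"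
proof (cases "C = {}")
  case True
  then have "S = {}" using C by auto
  then have "space (restrict_space borel S \<Otimes>\<^sub>M M) = {}"
    by (simp add: space_pair_measure space_restrict_space)
  then show ?thesis by (simp add: measurable_def)
next
  case False
  define c where "c = from_nat_into C"
  have c_range: "c i \<in> C" for i
    unfolding c_def using False by (rule from_nat_into)
  define q where "q n x = c (LEAST i. dist x (c i) < 1 / Suc n)" for n :: nat and x
  have near: "dist x (q n x) < 1 / Suc n" if x: "x \<in> S" for x n
  proof -
    obtain y where "y \<in> C" "dist y x < 1 / Suc n"
      using C(3) x by (meson closure_approachable of_nat_0_less_iff subsetD zero_less_Suc zero_less_divide_1_iff)
    then have "\<exists>i. dist x (c i) < 1 / Suc n"
      unfolding c_def by (metis C(1) dist_commute from_nat_into_surj)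
    then show ?thesis unfolding q_def by (rule LeastI_ex)
  qed
  have q_meas: "q n \<in> restrict_space borel S \<rightarrow>\<^sub>M count_space C" for n
  proof -
    have 1: "(\<lambda>x. dist x (c i)) \<in> borel_measurable borel" for i
      by (intro borel_measurable_continuous_onI continuous_intros)
    have "(\<lambda>x. LEAST i. dist x (c i) < 1 / Suc n) \<in> borel \<rightarrow>\<^sub>M count_space UNIV"
      by (intro measurable_Least) (use 1 in measurable)
    moreover have "c \<in> count_space UNIV \<rightarrow>\<^sub>M count_space C"
      using c_range by simp
    ultimately have "(\<lambda>x. c (LEAST i. dist x (c i) < 1 / Suc n)) \<in> borel \<rightarrow>\<^sub>M count_space C"
      by (rule measurable_compose)
    then show ?thesis unfolding q_def by (rule measurable_restrict_space1)
  qed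
  show ?thesis
  proof (rule borel_measurable_LIMSEQ_metric[where f = "\<lambda>n z. f (q n (fst z)) (snd z)"])
    fix n
    show "(\<lambda>z. f (q n (fst z)) (snd z)) \<in> borel_measurable (restrict_space borel S \<Otimes>\<^sub>M M)"
    proof (rule measurable_compose_countable'[OF _ _ C(1)])
      show "(\<lambda>z. f i (snd z)) \<in> borel_measurable (restrict_space borel S \<Otimes>\<^sub>M M)" if "i \<in> C" for i
        using meas[of i] that C(2) by (auto intro: measurable_compose[OF measurable_snd])
      show "(\<lambda>z. q n (fst z)) \<in> restrict_space borel S \<Otimes>\<^sub>M M \<rightarrow>\<^sub>M count_space C"
        by (rule measurable_compose[OF measurable_fst q_meas])
    qed
  next
    fix z assume "z \<in> space (restrict_space borel S \<Otimes>\<^sub>M M)"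
    then obtain x \<omega> where z: "z = (x, \<omega>)" and x: "x \<in> S" and \<omega>: "\<omega> \<in> space M"
      by (auto simp: space_pair_measure space_restrict_space)
    have "(\<lambda>n. dist (q n x) x) \<longlonglongrightarrow> 0"
    proof (rule Lim_null_comparison)
      show "\<forall>\<^sub>F n in sequentially. norm (dist (q n x) x) \<le> 1 / Suc n"
        using near[OF x] by (intro always_eventually) (auto simp: dist_commute intro: less_imp_le)
    qed (use LIMSEQ_inverse_real_of_nat in \<open>simp add: inverse_eq_divide\<close>)
    then have "(\<lambda>n. q n x) \<longlonglongrightarrow> x" by (rule tendsto_dist_iff[THEN iffD2])
    moreover have "q n x \<in> S" for n using c_range C(2) by (auto simp: q_def)
    ultimately have "(\<lambda>n. f (q n x) \<omega>) \<longlonglongrightarrow> f x \<omega>"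
      using continuous_on_tendsto_compose[OF cont[OF \<omega>], of "\<lambda>n. q n x" x sequentially] x by simp
    then show "(\<lambda>n. f (q n (fst z)) (snd z)) \<longlonglongrightarrow> (case z of (x, \<omega>) \<Rightarrow> f x \<omega>)"
      by (simp add: z)
  qed
qed

section \<open>Inverse matrices and Frobenius norms\<close>

lemma matrix_inv_invertible:
  fixes A :: "real ^ 'd ^ 'd"
  assumes "invertible A"
  shows "A ** matrix_inv A = mat 1" "matrix_inv A ** A = mat 1"
    "A *v (matrix_inv A *v x) = x" "matrix_inv A *v (A *v x) = x" "invertible (matrix_inv A)"
    "matrix_inv (matrix_inv A) = A"
proof -
  have *: "A ** matrix_inv A = mat 1 \<and> matrix_inv A ** A = mat 1"
    unfolding matrix_inv_def using assms unfolding invertible_def by (rule someI_ex)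
  then show 1: "A ** matrix_inv A = mat 1" and 2: "matrix_inv A ** A = mat 1" by auto
  then show "A *v (matrix_inv A *v x) = x" "matrix_inv A *v (A *v x) = x"
    by (simp_all add: matrix_vector_mul_assoc)
  show 3: "invertible (matrix_inv A)" using * unfolding invertible_def by blast
  have "matrix_inv A ** matrix_inv (matrix_inv A) = mat 1"
    unfolding matrix_inv_def[of "matrix_inv A"] using someI_ex[OF 3[unfolded invertible_def]] by blast
  then have "A ** (matrix_inv A ** matrix_inv (matrix_inv A)) = A ** mat 1" by simp
  then show "matrix_inv (matrix_inv A) = A" by (simp add: matrix_mul_assoc 1)
qed

lemma invertible_mult_nonzero:
  fixes A :: "real ^ 'd ^ 'd"
  assumes "invertible A" "x \<noteq> 0"
  shows "A *v x \<noteq> 0"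
  using matrix_inv_invertible(4)[OF assms(1), of x] assms(2) by auto

text \<open>
  Cramer's rule expresses the inverse through determinants, which are polynomials in the entries; this
  makes inversion continuous and measurable on the invertible matrices.
\<close>

lemma matrix_inv_cramer:
  fixes A :: "real ^ 'd ^ 'd"
  assumes "invertible A"
  shows "matrix_inv A = (\<chi> k l. det (\<chi> i j. if j = k then axis l 1 $ i else A $ i $ j) / det A)"
proof -
  have "matrix_inv A *v axis l 1 = (\<chi> k. det (\<chi> i j. if j = k then axis l 1 $ i else A $ i $ j) / det A)" for l
    using assms by (subst cramer[symmetric]) (auto simp: invertible_det_nz matrix_inv_invertible)
  from this[THEN arg_cong[where f = "\<lambda>v. v $ k" for k]] show ?thesis
    by (simp add: vec_eq_iff matrix_vector_mul_component inner_axis)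
qed

lemma continuous_on_det:
  fixes A :: "'a::topological_space \<Rightarrow> real ^ 'd ^ 'd"
  assumes "\<And>i j. continuous_on S (\<lambda>s. A s $ i $ j)"
  shows "continuous_on S (\<lambda>s. det (A s))"
  unfolding det_def by (intro continuous_intros assms)

lemma continuous_on_matrix_inv:
  fixes A :: "'a::topological_space \<Rightarrow> real ^ 'd ^ 'd"
  assumes cont: "continuous_on S A" and inv: "\<And>s. s \<in> S \<Longrightarrow> invertible (A s)"
  shows "continuous_on S (\<lambda>s. matrix_inv (A s))"
proof -
  have entry: "continuous_on S (\<lambda>s. A s $ i $ j)" for i j
    by (intro continuous_intros cont)
  have num: "continuous_on S (\<lambda>s. det (\<chi> i j. if j = k then axis l 1 $ i else A s $ i $ j))" for k l
  proof (rule continuous_on_det)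
    show "continuous_on S (\<lambda>s. (\<chi> i j. if j = k then axis l 1 $ i else A s $ i $ j) $ i $ j)" for i j
      by (cases "j = k") (simp_all add: entry)
  qed
  have den: "continuous_on S (\<lambda>s. det (A s))"
    by (intro continuous_on_det entry)
  have nz: "\<forall>s\<in>S. det (A s) \<noteq> 0"
    using inv by (simp add: invertible_det_nz)
  have "continuous_on S (\<lambda>s. \<chi> k l. det (\<chi> i j. if j = k then axis l 1 $ i else A s $ i $ j) / det (A s))"
    by (intro continuous_on_vec_lambda continuous_on_divide num den nz)
  then show ?thesis
    by (rule continuous_on_cong[THEN iffD1, rotated -1]) (simp_all add: matrix_inv_cramer inv)
qed

lemma borel_measurable_matrix_inv:
  fixes A :: "'w \<Rightarrow> real ^ 'd ^ 'd"
  assumes meas: "A \<in> borel_measurable M" and inv: "\<And>\<omega>. \<omega> \<in> space M \<Longrightarrow> invertible (A \<omega>)"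
  shows "(\<lambda>\<omega>. matrix_inv (A \<omega>)) \<in> borel_measurable M"
proof (rule measurable_compose[of A M "restrict_space borel (Collect invertible)"])
  show "A \<in> M \<rightarrow>\<^sub>M restrict_space borel (Collect invertible)"
    using meas inv by (intro measurable_restrict_space2) auto
  have "continuous_on (Collect invertible) (\<lambda>B :: real ^ 'd ^ 'd. matrix_inv B)"
    by (rule continuous_on_matrix_inv) (simp_all add: continuous_on_id)
  then show "matrix_inv \<in> borel_measurable (restrict_space borel (Collect invertible :: (real ^ 'd ^ 'd) set))"
    by (rule borel_measurable_continuous_on_restrict)
qed

text \<open>
  The norm of the type \<open>real ^ 'n ^ 'm\<close> is the Frobenius norm. Using it as a bound instead of the
  operator norm makes continuity and measurability of the bounds immediate.
\<close>

lemma norm_matrix_vector_mult_le: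
  fixes A :: "real ^ 'n ^ 'm"
  shows "norm (A *v x) \<le> norm A * norm x"
proof -
  have "norm (A *v x) = L2_set (\<lambda>i. \<bar>A $ i \<bullet> x\<bar>) UNIV"
    by (simp add: norm_vec_def matrix_vector_mult_def inner_vec_def)
  also have "\<dots> \<le> L2_set (\<lambda>i. norm (A $ i) * norm x) UNIV"
    by (intro L2_set_mono) (auto simp: Cauchy_Schwarz_ineq2)
  also have "\<dots> = norm A * norm x"
    by (simp add: norm_vec_def L2_set_left_distrib)
  finally show ?thesis .
qed

lemma bounded_bilinear_matrix_vector_mult:
  "bounded_bilinear ((*v) :: real ^ 'n ^ 'm \<Rightarrow> real ^ 'n \<Rightarrow> real ^ 'm)"
proof
  show "\<exists>K. \<forall>(A :: real ^ 'n ^ 'm) x. norm (A *v x) \<le> norm A * norm x * K"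
    using norm_matrix_vector_mult_le by (intro exI[of _ 1] allI) (simp only: mult_1_right)
qed (simp_all add: matrix_vector_mult_add_rdistrib matrix_vector_right_distrib
    scaleR_matrix_vector_assoc matrix_vector_mult_scaleR)

lemma borel_measurable_matrix_vector_mult:
  fixes A :: "'w \<Rightarrow> real ^ 'n ^ 'm"
  assumes "A \<in> borel_measurable M" "v \<in> borel_measurable M"
  shows "(\<lambda>\<omega>. A \<omega> *v v \<omega>) \<in> borel_measurable M"
  by (rule borel_measurable_continuous_Pair[OF assms])
    (intro bounded_bilinear.continuous_on[OF bounded_bilinear_matrix_vector_mult] continuous_intros)

section \<open>Linear maps acting on projective space\<close>

lemma proj_rel_refl: "x \<noteq> 0 \<Longrightarrow> proj_rel x x"
  unfolding proj_rel_def by (auto intro: exI[of _ 1])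

lemma dist_abs_proj:
  fixes x y :: "real ^ 'd"
  assumes "x \<noteq> 0" "y \<noteq> 0"
  shows "dist (abs_proj x) (abs_proj y) = min (norm (sgn x - sgn y)) (norm (sgn x + sgn y))"
  using dist_proj.abs_eq[OF proj_rel_refl[OF assms(1)] proj_rel_refl[OF assms(2)]]
  by (simp add: sgn_div_norm)

lemma abs_proj_eq_iff:
  assumes "x \<noteq> 0" "y \<noteq> 0"
  shows "abs_proj x = abs_proj y \<longleftrightarrow> (\<exists>c. c \<noteq> 0 \<and> y = c *\<^sub>R x)"
proof -
  have "abs_proj x = abs_proj y \<longleftrightarrow> proj_rel x y"
    using Quotient_rel[OF Quotient_proj, of x y] proj_rel_refl[OF assms(1)] proj_rel_refl[OF assms(2)]
    by simp
  then show ?thesis using assms by (simp add: proj_rel_def)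
qed

lemma abs_proj_cases:
  obtains x where "norm x = 1" "p = abs_proj x"
proof -
  have *: "proj_rel (rep_proj p) (rep_proj p)" "abs_proj (rep_proj p) = p"
    using Quotient_rep_reflp[OF Quotient_proj] Quotient_abs_rep[OF Quotient_proj] by auto
  then have nz: "rep_proj p \<noteq> 0" by (simp add: proj_rel_def)
  show thesis
  proof (rule that)
    show "norm (sgn (rep_proj p)) = 1" using nz by (simp add: norm_sgn)
    show "p = abs_proj (sgn (rep_proj p))"
      using abs_proj_eq_iff[of "rep_proj p" "sgn (rep_proj p)"] nz *(2)
      by (auto simp: sgn_div_norm sgn_zero_iff intro: exI[of _ "inverse (norm (rep_proj p))"])
  qed
qed

lemma continuous_on_abs_proj: "continuous_on (- {0}) (abs_proj :: real ^ 'd \<Rightarrow> 'd proj)"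
  unfolding continuous_on_def
proof
  fix x :: "real ^ 'd" assume x: "x \<in> - {0}"
  have 1: "((\<lambda>y. norm (sgn y - sgn x)) \<longlongrightarrow> norm (sgn x - sgn x)) (at x within - {0})"
    using x by (intro tendsto_intros) auto
  have "((\<lambda>y. dist (abs_proj y) (abs_proj x)) \<longlongrightarrow> 0) (at x within - {0})"
  proof (rule Lim_null_comparison)
    show "\<forall>\<^sub>F y in at x within - {0}. norm (dist (abs_proj y) (abs_proj x)) \<le> norm (sgn y - sgn x)"
      using x by (auto simp: eventually_at_filter dist_abs_proj)
  qed (use 1 in simp)
  then show "(abs_proj \<longlongrightarrow> abs_proj x) (at x within - {0})"
    by (rule tendsto_dist_iff[THEN iffD2])
qed

lemma separable_proj:
  obtains C :: "'d::finite proj set" where "countable C" "closure C = UNIV"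
proof -
  obtain D :: "(real ^ 'd) set" where D: "countable D" "D \<subseteq> - {0}" "- {0} \<subseteq> closure D"
    by (rule separable)
  show thesis
  proof (rule that[of "abs_proj ` D"])
    show "countable (abs_proj ` D)" using D(1) by simp
    have "p \<in> closure (abs_proj ` D)" for p :: "'d proj"
    proof -
      obtain x :: "real ^ 'd" where x: "norm x = 1" "p = abs_proj x" by (rule abs_proj_cases)
      then have "x \<in> closure D" using D(3) by auto
      then obtain s where s: "\<And>n. s n \<in> D" "s \<longlonglongrightarrow> x"
        unfolding closure_sequential by blast
      have "s n \<in> - {0}" for n using s(1) D(2) by blast
      then have "(\<lambda>n. abs_proj (s n)) \<longlonglongrightarrow> abs_proj x"
        using s(2) x by (intro continuous_on_tendsto_compose[OF continuous_on_abs_proj] always_eventually) auto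
      then show ?thesis
        unfolding closure_sequential x(2) using s(1) by (intro exI[of _ "\<lambda>n. abs_proj (s n)"]) simp
    qed
    then show "closure (abs_proj ` D) = (UNIV :: 'd proj set)" by blast
  qed
qed

lemma proj_map_inverse:
  assumes "invertible A"
  shows "proj_map (matrix_inv A) (proj_map A p) = p"
proof -
  obtain x where x: "norm x = 1" "p = abs_proj x" by (rule abs_proj_cases)
  then have "x \<noteq> 0" by auto
  then show ?thesis
    using assms by (simp add: x proj_map_abs_proj matrix_inv_invertible invertible_mult_nonzero)
qed

lemma bij_proj_map:
  assumes "invertible A"
  shows "bij (proj_map A)" "inv (proj_map A) = proj_map (matrix_inv A)"
proof -
  have 1: "proj_map A (proj_map (matrix_inv A) p) = p" for p
    using proj_map_inverse[of "matrix_inv A" p] assms by (simp add: matrix_inv_invertible)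
  show "bij (proj_map A)"
    by (rule o_bij[of "proj_map (matrix_inv A)"]) (auto simp: fun_eq_iff proj_map_inverse assms 1)
  show "inv (proj_map A) = proj_map (matrix_inv A)"
    by (rule inv_equality) (auto simp: proj_map_inverse assms 1)
qed

text \<open>
  Normalisation \<open>x \<mapsto> x / \<parallel>x\<parallel>\<close> is Lipschitz away from the origin: after multiplication by \<open>\<parallel>x\<parallel>\<close>,
  the error made by dividing \<open>y\<close> by the wrong norm is \<open>|\<parallel>x\<parallel> - \<parallel>y\<parallel>| \<le> \<parallel>x - y\<parallel>\<close>.
\<close>

lemma norm_sgn_diff_le:
  fixes x y :: "'a::real_normed_vector"
  assumes "x \<noteq> 0"
  shows "norm (sgn x - sgn y) \<le> 2 * norm (x - y) / norm x"
proof -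
  have "norm x *\<^sub>R (sgn x - sgn y) = (x - y) - (norm x - norm y) *\<^sub>R sgn y"
    using assms by (cases "y = 0") (simp_all add: scaleR_diff_right left_diff_distrib scaleR_left_diff_distrib sgn_div_norm)
  then have "norm x * norm (sgn x - sgn y) = norm ((x - y) - (norm x - norm y) *\<^sub>R sgn y)"
    by (metis norm_scaleR abs_norm_cancel)
  also have "\<dots> \<le> norm (x - y) + \<bar>norm x - norm y\<bar> * norm (sgn y)"
    by (metis norm_triangle_ineq4 norm_scaleR)
  also have "\<dots> \<le> norm (x - y) + \<bar>norm x - norm y\<bar> * 1"
    by (intro add_left_mono mult_left_mono) (auto simp: norm_sgn)
  also have "\<dots> \<le> 2 * norm (x - y)"
    using norm_triangle_ineq3[of x y] by simp
  finally show ?thesis using assms by (simp add: field_simps)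
qed

text \<open>
  On unit vectors \<open>A\<close> stretches differences by at most \<open>\<parallel>A\<parallel>\<close>, while the image has length at least
  \<open>1 / \<parallel>A\<inverse>\<parallel>\<close>, so that normalising it costs at most the factor \<open>2 \<parallel>A\<inverse>\<parallel>\<close>. Both choices of sign in
  the projective metric are covered by replacing \<open>y\<close> with \<open>-y\<close>.
\<close>

lemma dist_proj_map_le:
  assumes A: "invertible A"
  shows "dist (proj_map A p) (proj_map A q) \<le> 2 * norm A * norm (matrix_inv A) * dist p q"
proof -
  obtain x where x: "norm x = 1" "p = abs_proj x" by (rule abs_proj_cases)
  obtain y where y: "norm y = 1" "q = abs_proj y" by (rule abs_proj_cases)
  have nz: "x \<noteq> 0" "y \<noteq> 0" using x y by auto
  have low: "1 \<le> norm (matrix_inv A) * norm (A *v x)"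
    using norm_matrix_vector_mult_le[of "matrix_inv A" "A *v x"] A x by (simp add: matrix_inv_invertible)
  have *: "norm (sgn (A *v x) - sgn (A *v z)) \<le> 2 * norm A * norm (matrix_inv A) * norm (x - z)" for z
  proof -
    have nzA: "A *v x \<noteq> 0" using A nz by (simp add: invertible_mult_nonzero)
    have "norm (sgn (A *v x) - sgn (A *v z)) \<le> 2 * norm (A *v (x - z)) / norm (A *v x)"
      using norm_sgn_diff_le[OF nzA, of "A *v z"] by (simp add: matrix_vector_mult_diff_distrib)
    also have "\<dots> = 2 * norm (A *v (x - z)) * (1 / norm (A *v x))" by simp
    also have "\<dots> \<le> 2 * (norm A * norm (x - z)) * norm (matrix_inv A)"
      using low nzA by (intro mult_mono norm_matrix_vector_mult_le) (auto simp: field_simps)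
    finally show ?thesis by (simp add: mult_ac)
  qed
  have neg: "A *v (- y) = - (A *v y)"
    by (metis matrix_vector_mult_scaleR scaleR_minus1_left)
  have "dist (proj_map A p) (proj_map A q) = min (norm (sgn (A *v x) - sgn (A *v y))) (norm (sgn (A *v x) + sgn (A *v y)))"
    using A nz by (simp add: x y proj_map_abs_proj dist_abs_proj invertible_mult_nonzero)
  also have "\<dots> \<le> 2 * norm A * norm (matrix_inv A) * min (norm (x - y)) (norm (x + y))"
    using *[of y] *[of "- y"] by (auto simp: neg sgn_minus min_def)
  also have "min (norm (x - y)) (norm (x + y)) = dist p q"
    using nz x y by (simp add: dist_abs_proj sgn_div_norm)
  finally show ?thesis .
qed

lemma continuous_on_proj_map:
  assumes "invertible A"
  shows "continuous_on S (proj_map A)"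
proof (rule lipschitz_on_continuous_on)
  show "(2 * norm A * norm (matrix_inv A))-lipschitz_on S (proj_map A)"
    using dist_proj_map_le[OF assms] by (intro lipschitz_onI) auto
qed

lemma borel_measurable_proj_map:
  fixes G :: "'w \<Rightarrow> real ^ 'd ^ 'd"
  assumes meas: "G \<in> borel_measurable M" and inv: "\<And>\<omega>. \<omega> \<in> space M \<Longrightarrow> invertible (G \<omega>)"
  shows "(\<lambda>(p, \<omega>). proj_map (G \<omega>) p) \<in> borel_measurable (borel \<Otimes>\<^sub>M M)"
proof -
  obtain C :: "'d proj set" where C: "countable C" "closure C = UNIV" by (rule separable_proj)
  have "(\<lambda>(p, \<omega>). proj_map (G \<omega>) p) \<in> borel_measurable (restrict_space borel UNIV \<Otimes>\<^sub>M M)"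
  proof (rule caratheodory_measurable[OF C(1)])
    show "continuous_on UNIV (\<lambda>p. proj_map (G \<omega>) p)" if "\<omega> \<in> space M" for \<omega>
      using continuous_on_proj_map[OF inv[OF that]] .
    show "(\<lambda>\<omega>. proj_map (G \<omega>) p) \<in> borel_measurable M" for p
    proof -
      obtain x where x: "norm x = 1" "p = abs_proj x" by (rule abs_proj_cases)
      then have nz: "x \<noteq> 0" by auto
      have "(\<lambda>\<omega>. G \<omega> *v x) \<in> M \<rightarrow>\<^sub>M restrict_space borel (- {0})"
        using nz by (intro measurable_restrict_space2 borel_measurable_matrix_vector_mult meas)
          (auto simp: invertible_mult_nonzero inv)
      then have "(\<lambda>\<omega>. abs_proj (G \<omega> *v x)) \<in> borel_measurable M"
        by (rule measurable_compose)
          (rule borel_measurable_continuous_on_restrict[OF continuous_on_abs_proj])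
      then show ?thesis
        by (rule measurable_cong[THEN iffD1, rotated]) (simp add: x(2) proj_map_abs_proj inv nz)
    qed
  qed (use C in auto)
  moreover have "sets (restrict_space borel UNIV) = sets (borel :: 'd proj measure)"
    by (simp add: sets_restrict_space)
  ultimately show ?thesis
    by (simp cong: measurable_cong_sets sets_pair_measure_cong)
qed

section \<open>Random conjugacies preserve weak Morse decompositions\<close>

definition fibre_image :: "('w \<Rightarrow> 'x \<Rightarrow> 'y) \<Rightarrow> ('w \<Rightarrow> 'x set) \<Rightarrow> 'w \<Rightarrow> 'y set" where
  "fibre_image h D \<omega> = h \<omega> ` D \<omega>"

text \<open>
  The Lipschitz bound for the semidistance in the form in which the events defining convergence in
  probability are compared. The empty set is harmless: an empty \<open>A\<close> has semidistance \<open>0\<close>, and a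
  nonempty \<open>A\<close> has semidistance \<open>\<infinity>\<close> from an empty \<open>B\<close>, before and after applying \<open>f\<close>.
\<close>

lemma semi_dist_image_gt:
  fixes f :: "'x::metric_space \<Rightarrow> 'y::metric_space"
  assumes lip: "\<And>x y. dist (f x) (f y) \<le> K * dist x y" and K: "0 < K" and \<epsilon>: "0 < \<epsilon>"
    and gt: "ereal \<epsilon> < semi_dist (f ` A) (f ` B)"
  shows "ereal (\<epsilon> / K) < semi_dist A B"
proof (rule ccontr)
  assume le: "\<not> ereal (\<epsilon> / K) < semi_dist A B"
  have A: "A \<noteq> {}" using gt \<epsilon> by (auto simp: semi_dist_def)
  have B: "B \<noteq> {}" using le A by (auto simp: semi_dist_def)
  have "(INF b\<in>f ` B. ereal (dist (f a) b)) \<le> ereal \<epsilon>" if a: "a \<in> A" for a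
  proof (rule ereal_le_epsilon2)
    fix e :: real assume e: "0 < e"
    have "(INF b\<in>B. ereal (dist a b)) \<le> semi_dist A B"
      using a A B by (auto simp: semi_dist_def intro: SUP_upper)
    also have "\<dots> \<le> ereal (\<epsilon> / K)" using le by simp
    also have "\<dots> < ereal (\<epsilon> / K + e / K)" using e K by simp
    finally obtain b where b: "b \<in> B" "dist a b < \<epsilon> / K + e / K"
      by (auto simp: INF_less_iff)
    have "dist (f a) (f b) \<le> K * dist a b" by (rule lip)
    also have "\<dots> \<le> K * (\<epsilon> / K + e / K)" using b K by (intro mult_left_mono) auto
    also have "\<dots> = \<epsilon> + e" using K by (simp add: field_simps)
    finally show "(INF b\<in>f ` B. ereal (dist (f a) b)) \<le> ereal \<epsilon> + ereal e"
      using b by (intro INF_lower2[of "f b"]) auto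
  qed
  then have "semi_dist (f ` A) (f ` B) \<le> ereal \<epsilon>"
    using A B by (auto simp: semi_dist_def intro!: SUP_least)
  then show False using gt by simp
qed

text \<open>
  Tightness of a single real random variable, which turns the random Lipschitz constant of a conjugacy
  into a deterministic one off an event of small probability.
\<close>

lemma (in prob_space) real_random_variable_tight:
  fixes L :: "'a \<Rightarrow> real"
  assumes L: "L \<in> borel_measurable M" and \<eta>: "0 < \<eta>"
  obtains K where "0 < K" "emeasure M {\<omega> \<in> space M. K < L \<omega>} < ennreal \<eta>"
proof -
  define A where "A n = {\<omega> \<in> space M. real n < L \<omega>}" for n
  have "(\<lambda>n. emeasure M (A n)) \<longlonglongrightarrow> emeasure M (\<Inter>n. A n)"
  proof (rule Lim_emeasure_decseq)
    have "A n \<in> sets M" for n unfolding A_def using L by measurable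
    then show "range A \<subseteq> sets M" by blast
    show "decseq A" by (rule decseq_SucI) (auto simp: A_def)
  qed simp
  also have "(\<Inter>n. A n) = {}"
  proof -
    have "\<exists>n. \<not> real n < L \<omega>" for \<omega>
      using reals_Archimedean2[of "L \<omega>"] by (auto intro: less_imp_le simp: not_less)
    then show ?thesis by (simp add: A_def set_eq_iff)
  qed
  finally have "\<forall>\<^sub>F n in sequentially. emeasure M (A n) < ennreal \<eta>"
    using \<eta> by (simp add: order_tendsto_iff)
  then obtain N where N: "\<And>n. n \<ge> N \<Longrightarrow> emeasure M (A n) < ennreal \<eta>"
    by (auto simp: eventually_sequentially)
  show thesis
    using N[of "Suc N"] by (intro that[of "real (Suc N)"]) (auto simp: A_def)
qed

text \<open>
  A fibrewise bijection, measurable together with its inverse, that conjugates two systems over the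
  same base flow and is bi-Lipschitz with a random constant. The bijectivity is demanded at every
  \<open>\<omega>\<close>, even outside \<open>space M\<close>: a decomposition is a set of functions defined on the whole type, and
  transporting it back and forth must give the same functions again.
\<close>

locale random_conjugacy = prob_space M for M :: "'w measure" +
  fixes T :: "real set" and \<theta> :: "real \<Rightarrow> 'w \<Rightarrow> 'w"
    and \<phi> :: "real \<Rightarrow> 'w \<Rightarrow> 'x::metric_space \<Rightarrow> 'x"
    and \<psi> :: "real \<Rightarrow> 'w \<Rightarrow> 'y::metric_space \<Rightarrow> 'y"
    and h :: "'w \<Rightarrow> 'x \<Rightarrow> 'y" and L :: "'w \<Rightarrow> real"
  assumes \<theta>_measurable: "t \<in> T \<Longrightarrow> \<theta> t \<in> M \<rightarrow>\<^sub>M M"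
    and \<theta>_preserving: "t \<in> T \<Longrightarrow> distr M M (\<theta> t) = M"
    and bij_h: "bij (h \<omega>)"
    and h_measurable: "(\<lambda>(x, \<omega>). h \<omega> x) \<in> borel_measurable (borel \<Otimes>\<^sub>M M)"
    and inv_h_measurable: "(\<lambda>(y, \<omega>). inv (h \<omega>) y) \<in> borel_measurable (borel \<Otimes>\<^sub>M M)"
    and L_measurable: "L \<in> borel_measurable M"
    and h_lipschitz: "\<omega> \<in> space M \<Longrightarrow> dist (h \<omega> x) (h \<omega> x') \<le> L \<omega> * dist x x'"
    and inv_h_lipschitz: "\<omega> \<in> space M \<Longrightarrow> dist (inv (h \<omega>) y) (inv (h \<omega>) y') \<le> L \<omega> * dist y y'"
    and conjugates: "\<omega> \<in> space M \<Longrightarrow> t \<in> T \<Longrightarrow> \<psi> t \<omega> (h \<omega> x) = h (\<theta> t \<omega>) (\<phi> t \<omega> x)"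
begin

lemma inv_h[simp]: "inv (h \<omega>) (h \<omega> x) = x" "h \<omega> (inv (h \<omega>) y) = y"
  using bij_h by (simp_all add: bij_is_inj bij_is_surj surj_f_inv_f)

lemma \<theta>_space: "t \<in> T \<Longrightarrow> \<omega> \<in> space M \<Longrightarrow> \<theta> t \<omega> \<in> space M"
  using measurable_space[OF \<theta>_measurable] .

lemma inverse_conjugacy: "random_conjugacy M T \<theta> \<psi> \<phi> (\<lambda>\<omega>. inv (h \<omega>)) L"
proof
  show "\<phi> t \<omega> (inv (h \<omega>) y) = inv (h (\<theta> t \<omega>)) (\<psi> t \<omega> y)" if "\<omega> \<in> space M" "t \<in> T" for t \<omega> y
    using conjugates[OF that, of "inv (h \<omega>) y"] by simp
qed (simp_all add: \<theta>_measurable \<theta>_preserving bij_h bij_imp_bij_inv inv_inv_eq h_measurable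
    inv_h_measurable L_measurable h_lipschitz inv_h_lipschitz)

lemma fibre_image_inverse[simp]:
  "fibre_image (\<lambda>\<omega>. inv (h \<omega>)) (fibre_image h D) = D"
  "fibre_image h (fibre_image (\<lambda>\<omega>. inv (h \<omega>)) E) = E"
  by (auto simp: fibre_image_def fun_eq_iff image_iff)

text \<open>
  Since \<open>h\<close> is bijective, images are inverse images under \<open>inv (h \<omega>)\<close>. This makes them commute with
  complements and intersections, and reduces measurability of the transported random set to
  measurability of the inverse.
\<close>

lemma fibre_image_eq_vimage: "fibre_image h D \<omega> = inv (h \<omega>) -` D \<omega>"
  using bij_h by (simp add: fibre_image_def bij_vimage_eq_inv_image bij_imp_bij_inv inv_inv_eq)

lemma fibre_image_subset_iff: "fibre_image h D \<omega> \<subseteq> fibre_image h E \<omega> \<longleftrightarrow> D \<omega> \<subseteq> E \<omega>"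
  using bij_h by (simp add: fibre_image_def bij_is_inj inj_image_subset_iff)

lemma random_set_fibre_image:
  assumes "random_set M D"
  shows "random_set M (fibre_image h D)"
proof -
  have "(\<lambda>(y, \<omega>). (inv (h \<omega>) y, \<omega>)) \<in> borel \<Otimes>\<^sub>M M \<rightarrow>\<^sub>M borel \<Otimes>\<^sub>M M"
    using measurable_Pair[OF inv_h_measurable measurable_snd] by (simp add: case_prod_beta)
  from measurable_sets[OF this assms[unfolded random_set_def]]
  have "(\<lambda>(y, \<omega>). (inv (h \<omega>) y, \<omega>)) -` {(x, \<omega>). \<omega> \<in> space M \<and> x \<in> D \<omega>} \<inter> space (borel \<Otimes>\<^sub>M M)
    \<in> sets (borel \<Otimes>\<^sub>M M)" .
  also have "(\<lambda>(y, \<omega>). (inv (h \<omega>) y, \<omega>)) -` {(x, \<omega>). \<omega> \<in> space M \<and> x \<in> D \<omega>} \<inter> space (borel \<Otimes>\<^sub>M M)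
    = {(y, \<omega>). \<omega> \<in> space M \<and> y \<in> fibre_image h D \<omega>}"
    by (auto simp: space_pair_measure fibre_image_eq_vimage)
  finally show ?thesis by (simp add: random_set_def)
qed

lemma continuous_h:
  assumes "\<omega> \<in> space M"
  shows "continuous_on S (h \<omega>)" "continuous_on S' (inv (h \<omega>))"
proof -
  have L: "L \<omega> \<le> max 0 (L \<omega>)" by simp
  have "(max 0 (L \<omega>))-lipschitz_on S (h \<omega>)"
    by (intro lipschitz_onI order_trans[OF h_lipschitz[OF assms] mult_right_mono[OF L]]) auto
  then show "continuous_on S (h \<omega>)" by (rule lipschitz_on_continuous_on)
  have "(max 0 (L \<omega>))-lipschitz_on S' (inv (h \<omega>))"
    by (intro lipschitz_onI order_trans[OF inv_h_lipschitz[OF assms] mult_right_mono[OF L]]) auto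
  then show "continuous_on S' (inv (h \<omega>))" by (rule lipschitz_on_continuous_on)
qed

lemma open_random_set_fibre_image: "open_random_set M D \<Longrightarrow> open_random_set M (fibre_image h D)"
  unfolding open_random_set_def
  by (auto simp: random_set_fibre_image fibre_image_eq_vimage intro: open_vimage continuous_h)

lemma closed_random_set_fibre_image: "closed_random_set M D \<Longrightarrow> closed_random_set M (fibre_image h D)"
  unfolding closed_random_set_def
  by (auto simp: random_set_fibre_image fibre_image_eq_vimage intro: closed_vimage continuous_h)

lemma compact_random_set_fibre_image: "compact_random_set M D \<Longrightarrow> compact_random_set M (fibre_image h D)"
  unfolding compact_random_set_def
  by (auto simp: random_set_fibre_image fibre_image_def intro: compact_continuous_image continuous_h)

lemma image_fibre_image:
  assumes "\<omega> \<in> space M" "t \<in> T"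
  shows "\<psi> t \<omega> ` fibre_image h D \<omega> = h (\<theta> t \<omega>) ` \<phi> t \<omega> ` D \<omega>"
  using conjugates[OF assms] by (simp add: fibre_image_def image_image)

lemma forward_invariant_fibre_image:
  "forward_invariant M T \<theta> \<phi> D \<Longrightarrow> forward_invariant M T \<theta> \<psi> (fibre_image h D)"
  unfolding forward_invariant_def
  by (metis fibre_image_def image_fibre_image image_mono)

lemma invariant_fibre_image:
  "invariant M T \<theta> \<phi> D \<Longrightarrow> invariant M T \<theta> \<psi> (fibre_image h D)"
  unfolding invariant_def by (simp add: image_fibre_image) (simp add: fibre_image_def)

text \<open>
  Fix a bound \<open>r\<close> on the probability. Choose \<open>K\<close> with \<open>L \<le> K\<close> off an event of probability \<open>r/2\<close>;
  since \<open>\<theta>\<close> preserves the measure, also \<open>L (\<theta> t \<omega>) \<le> K\<close> off an event of probability \<open>r/2\<close>, for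
  every \<open>t\<close>. There a semidistance exceeding \<open>\<epsilon>\<close> after applying \<open>h\<close> must have exceeded \<open>\<epsilon>/K\<close>
  before, which for large \<open>t\<close> has outer probability below \<open>r/2\<close>.
\<close>

lemma attraction_fibre_image:
  assumes attr: "\<And>\<delta>::real. 0 < \<delta> \<Longrightarrow>
      ((\<lambda>t. outer_measure_of M {\<omega> \<in> space M. ereal \<delta> < semi_dist (\<phi> t \<omega> ` C \<omega>) (A (\<theta> t \<omega>))}) \<longlongrightarrow> 0)
        (inf at_top (principal T))"
    and \<epsilon>: "0 < (\<epsilon>::real)"
  shows "((\<lambda>t. outer_measure_of M
      {\<omega> \<in> space M. ereal \<epsilon> < semi_dist (\<psi> t \<omega> ` fibre_image h C \<omega>) (fibre_image h A (\<theta> t \<omega>))}) \<longlongrightarrow> 0)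
        (inf at_top (principal T))" (is "(?\<mu> \<longlongrightarrow> 0) ?F")
proof (rule order_tendstoI)
  fix e :: ennreal assume "0 < e"
  then obtain r where r: "0 < r" "ennreal r \<le> e"
    by (cases e) (auto simp: ennreal_less_zero_iff intro: that[of 1])
  obtain K where K: "0 < K" "emeasure M {\<omega> \<in> space M. K < L \<omega>} < ennreal (r / 2)"
    using real_random_variable_tight[OF L_measurable, of "r / 2"] r by auto
  have "\<forall>\<^sub>F t in ?F. outer_measure_of M
      {\<omega> \<in> space M. ereal (\<epsilon> / K) < semi_dist (\<phi> t \<omega> ` C \<omega>) (A (\<theta> t \<omega>))} < ennreal (r / 2)"
    using attr[of "\<epsilon> / K"] \<epsilon> K(1) r by (auto intro: order_tendstoD)
  moreover have "\<forall>\<^sub>F t in ?F. t \<in> T" by (simp add: eventually_inf_principal)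
  ultimately show "\<forall>\<^sub>F t in ?F. ?\<mu> t < e"
  proof eventually_elim
    case (elim t)
    \<comment> \<open>Outer measures enter through a measurable hull, so that ordinary subadditivity applies.\<close>
    define S where "S = {\<omega> \<in> space M. ereal (\<epsilon> / K) < semi_dist (\<phi> t \<omega> ` C \<omega>) (A (\<theta> t \<omega>))}"
    obtain E where E: "E \<in> sets M" "S \<subseteq> E" "outer_measure_of M S = emeasure M E"
      using outer_measure_of_attain[of S M] by (auto simp: S_def)
    define B where "B = {\<omega> \<in> space M. K < L \<omega>}"
    have B: "B \<in> sets M" unfolding B_def using L_measurable by measurable
    let ?B = "\<theta> t -` B \<inter> space M"
    have B': "?B \<in> sets M" using measurable_sets[OF \<theta>_measurable[OF elim(2)] B] .
    have "emeasure M ?B = emeasure M B"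
      using emeasure_distr[OF \<theta>_measurable[OF elim(2)] B] \<theta>_preserving[OF elim(2)] by simp
    then have small: "emeasure M ?B < ennreal (r / 2)" using K(2) by (simp add: B_def)
    have "{\<omega> \<in> space M. ereal \<epsilon> < semi_dist (\<psi> t \<omega> ` fibre_image h C \<omega>) (fibre_image h A (\<theta> t \<omega>))} \<subseteq> E \<union> ?B"
    proof
      fix \<omega> assume "\<omega> \<in> {\<omega> \<in> space M. ereal \<epsilon> < semi_dist (\<psi> t \<omega> ` fibre_image h C \<omega>) (fibre_image h A (\<theta> t \<omega>))}"
      then have \<omega>: "\<omega> \<in> space M"
        and gt: "ereal \<epsilon> < semi_dist (h (\<theta> t \<omega>) ` \<phi> t \<omega> ` C \<omega>) (h (\<theta> t \<omega>) ` A (\<theta> t \<omega>))"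
        using elim(2) by (auto simp: image_fibre_image) (simp add: fibre_image_def)
      have \<theta>\<omega>: "\<theta> t \<omega> \<in> space M" using \<theta>_space[OF elim(2) \<omega>] .
      show "\<omega> \<in> E \<union> ?B"
      proof (cases "K < L (\<theta> t \<omega>)")
        case True
        then show ?thesis using \<omega> \<theta>\<omega> by (simp add: B_def)
      next
        case False
        then have "dist (h (\<theta> t \<omega>) x) (h (\<theta> t \<omega>) y) \<le> K * dist x y" for x y
          by (intro order_trans[OF h_lipschitz[OF \<theta>\<omega>]] mult_right_mono) auto
        from semi_dist_image_gt[OF this K(1) \<epsilon> gt] have "\<omega> \<in> S" using \<omega> by (simp add: S_def)
        then show ?thesis using E(2) by blast
      qed
    qed
    then have "?\<mu> t \<le> outer_measure_of M (E \<union> ?B)" by (rule outer_measure_of_mono)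
    also have "\<dots> = emeasure M (E \<union> ?B)" using E(1) B' by (intro outer_measure_of_eq sets.Un)
    also have "\<dots> \<le> emeasure M E + emeasure M ?B" using E(1) B' by (rule emeasure_subadditive)
    also have "\<dots> < ennreal (r / 2) + ennreal (r / 2)"
      using elim(1) small E(3) by (intro add_strict_mono) (simp_all add: S_def)
    also have "\<dots> = ennreal r" using r by (simp flip: ennreal_plus)
    also have "\<dots> \<le> e" by (rule r(2))
    finally show ?case .
  qed
qed simp

text \<open>
  Every closed random subset of the image neighbourhood is itself the image of a closed random subset
  of \<open>U\<close>, because the inverse conjugacy transports closed random sets as well.
\<close>

lemma attracting_nbhd_fibre_image:
  assumes "attracting_nbhd M T \<theta> \<phi> A U"
  shows "attracting_nbhd M T \<theta> \<psi> (fibre_image h A) (fibre_image h U)"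
  unfolding attracting_nbhd_def
proof (intro conjI allI impI)
  show "open_random_set M (fibre_image h U)"
    using assms by (simp add: attracting_nbhd_def open_random_set_fibre_image)
  show "forward_invariant M T \<theta> \<psi> (fibre_image h U)"
    using assms by (simp add: attracting_nbhd_def forward_invariant_fibre_image)
  show "AE \<omega> in M. fibre_image h A \<omega> \<subseteq> fibre_image h U \<omega>"
    using assms by (simp add: attracting_nbhd_def fibre_image_subset_iff)
  fix C and \<epsilon> :: real
  assume C: "closed_random_set M C \<and> (\<forall>\<omega>\<in>space M. C \<omega> \<subseteq> fibre_image h U \<omega>)" and \<epsilon>: "0 < \<epsilon>"
  interpret inverse: random_conjugacy M T \<theta> \<psi> \<phi> "\<lambda>\<omega>. inv (h \<omega>)" L
    by (rule inverse_conjugacy)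
  define C' where "C' = fibre_image (\<lambda>\<omega>. inv (h \<omega>)) C"
  have C_eq: "C = fibre_image h C'" by (simp add: C'_def)
  have "closed_random_set M C'" "\<forall>\<omega>\<in>space M. C' \<omega> \<subseteq> U \<omega>"
    using C by (simp_all add: C'_def inverse.closed_random_set_fibre_image)
      (simp add: C_eq fibre_image_subset_iff)
  then have "((\<lambda>t. outer_measure_of M {\<omega> \<in> space M. ereal \<delta> < semi_dist (\<phi> t \<omega> ` C' \<omega>) (A (\<theta> t \<omega>))}) \<longlongrightarrow> 0)
      (inf at_top (principal T))" if "0 < \<delta>" for \<delta> :: real
    using assms that by (simp add: attracting_nbhd_def)
  then show "((\<lambda>t. outer_measure_of M
      {\<omega> \<in> space M. ereal \<epsilon> < semi_dist (\<psi> t \<omega> ` C \<omega>) (fibre_image h A (\<theta> t \<omega>))}) \<longlongrightarrow> 0)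
        (inf at_top (principal T))"
    unfolding C_eq using \<epsilon> by (rule attraction_fibre_image)
qed

lemma local_weak_attractor_fibre_image:
  "local_weak_attractor M T \<theta> \<phi> A \<Longrightarrow> local_weak_attractor M T \<theta> \<psi> (fibre_image h A)"
  unfolding local_weak_attractor_def
  using compact_random_set_fibre_image invariant_fibre_image attracting_nbhd_fibre_image by blast

lemma basin_fibre_image:
  assumes "\<omega> \<in> space M"
  shows "basin T \<theta> \<psi> (fibre_image h U) \<omega> = fibre_image h (basin T \<theta> \<phi> U) \<omega>"
proof -
  have "y \<in> basin T \<theta> \<psi> (fibre_image h U) \<omega> \<longleftrightarrow> inv (h \<omega>) y \<in> basin T \<theta> \<phi> U \<omega>" for y
    using conjugates[OF assms, of _ "inv (h \<omega>) y"] by (auto simp: basin_def fibre_image_eq_vimage)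
  then show ?thesis by (auto simp: fibre_image_eq_vimage)
qed

lemma weak_attractor_repeller_pair_fibre_image:
  assumes "weak_attractor_repeller_pair M T \<theta> \<phi> A R"
  shows "weak_attractor_repeller_pair M T \<theta> \<psi> (fibre_image h A) (fibre_image h R)"
proof -
  obtain U where U: "attracting_nbhd M T \<theta> \<phi> A U"
    "\<And>\<omega>. \<omega> \<in> space M \<Longrightarrow> R \<omega> = UNIV - basin T \<theta> \<phi> U \<omega>"
    using assms by (auto simp: weak_attractor_repeller_pair_def)
  have "fibre_image h R \<omega> = UNIV - basin T \<theta> \<psi> (fibre_image h U) \<omega>" if "\<omega> \<in> space M" for \<omega>
    unfolding basin_fibre_image[OF that] using U(2)[OF that] by (auto simp: fibre_image_eq_vimage)
  then show ?thesis
    using assms attracting_nbhd_fibre_image[OF U(1)] local_weak_attractor_fibre_image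
    unfolding weak_attractor_repeller_pair_def by blast
qed

lemma weak_Morse_decomposition_fibre_image:
  assumes "weak_Morse_decomposition M T \<theta> \<phi> \<M>"
  shows "weak_Morse_decomposition M T \<theta> \<psi> (fibre_image h ` \<M>)"
proof -
  obtain n A R where pairs: "\<And>i. i \<le> n \<Longrightarrow> weak_attractor_repeller_pair M T \<theta> \<phi> (A i) (R i)"
    and chain: "AE \<omega> in M. A 0 \<omega> = {} \<and> (\<forall>i<n. A i \<omega> \<subset> A (Suc i) \<omega>) \<and> A n \<omega> = UNIV"
    and \<M>: "\<M> = (\<lambda>i \<omega>. A i \<omega> \<inter> R (i - 1) \<omega>) ` {1..n::nat}"
    using assms unfolding weak_Morse_decomposition_def by blast
  show ?thesis
    unfolding weak_Morse_decomposition_def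
  proof (intro exI conjI allI impI)
    show "weak_attractor_repeller_pair M T \<theta> \<psi> (fibre_image h (A i)) (fibre_image h (R i))" if "i \<le> n" for i
      by (rule weak_attractor_repeller_pair_fibre_image[OF pairs[OF that]])
    show "AE \<omega> in M. fibre_image h (A 0) \<omega> = {} \<and>
        (\<forall>i<n. fibre_image h (A i) \<omega> \<subset> fibre_image h (A (Suc i)) \<omega>) \<and> fibre_image h (A n) \<omega> = UNIV"
      using chain
    proof eventually_elim
      case (elim \<omega>)
      then show ?case
        by (simp add: less_le_not_le fibre_image_subset_iff) (simp add: fibre_image_eq_vimage)
    qed
    show "fibre_image h ` \<M> = (\<lambda>i \<omega>. fibre_image h (A i) \<omega> \<inter> fibre_image h (R (i - 1)) \<omega>) ` {1..n}"
      unfolding \<M> image_image by (intro image_cong refl) (auto simp: fibre_image_eq_vimage)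
  qed
qed

lemma finer_fibre_image_iff: "finer M (fibre_image h ` \<M>) (fibre_image h ` \<N>) \<longleftrightarrow> finer M \<M> \<N>"
  by (simp add: finer_def fibre_image_subset_iff)

text \<open>
  A competitor of the image decomposition is pulled back by the inverse conjugacy, where minimality
  of \<open>\<M>\<close> applies.
\<close>

lemma finest_weak_Morse_decomposition_fibre_image:
  assumes "finest_weak_Morse_decomposition M T \<theta> \<phi> \<M>"
  shows "finest_weak_Morse_decomposition M T \<theta> \<psi> (fibre_image h ` \<M>)"
  unfolding finest_weak_Morse_decomposition_def
proof (intro conjI allI impI)
  show "weak_Morse_decomposition M T \<theta> \<psi> (fibre_image h ` \<M>)"
    using assms by (simp add: finest_weak_Morse_decomposition_def weak_Morse_decomposition_fibre_image)
  fix \<N> assume \<N>: "weak_Morse_decomposition M T \<theta> \<psi> \<N> \<and> finer M \<N> (fibre_image h ` \<M>)"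
  interpret inverse: random_conjugacy M T \<theta> \<psi> \<phi> "\<lambda>\<omega>. inv (h \<omega>)" L
    by (rule inverse_conjugacy)
  define \<N>' where "\<N>' = fibre_image (\<lambda>\<omega>. inv (h \<omega>)) ` \<N>"
  have \<N>_eq: "\<N> = fibre_image h ` \<N>'" by (simp add: \<N>'_def image_image)
  have "weak_Morse_decomposition M T \<theta> \<phi> \<N>'"
    using \<N> by (simp add: \<N>'_def inverse.weak_Morse_decomposition_fibre_image)
  moreover have "finer M \<N>' \<M>" using \<N> by (simp add: \<N>_eq finer_fibre_image_iff)
  ultimately show "finer M (fibre_image h ` \<M>) \<N>"
    using assms by (simp add: \<N>_eq finer_fibre_image_iff finest_weak_Morse_decomposition_def)
qed

end

section \<open>Invariance of Morse sets\<close>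

locale flow_on =
  fixes M :: "'w measure" and T :: "real set" and \<theta> :: "real \<Rightarrow> 'w \<Rightarrow> 'w"
  assumes T_zero: "0 \<in> T" and T_add: "s \<in> T \<Longrightarrow> t \<in> T \<Longrightarrow> s + t \<in> T" and T_uminus: "t \<in> T \<Longrightarrow> - t \<in> T"
    and T_closed: "closed T"
    and \<theta>_space: "t \<in> T \<Longrightarrow> \<omega> \<in> space M \<Longrightarrow> \<theta> t \<omega> \<in> space M"
    and \<theta>_zero: "\<omega> \<in> space M \<Longrightarrow> \<theta> 0 \<omega> = \<omega>"
    and \<theta>_add: "t \<in> T \<Longrightarrow> s \<in> T \<Longrightarrow> \<omega> \<in> space M \<Longrightarrow> \<theta> (t + s) \<omega> = \<theta> t (\<theta> s \<omega>)"

lemma ergodic_flow_imp_flow_on: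
  assumes "ergodic_flow M T d \<theta>"
  shows "flow_on M T \<theta>"
proof
  have T: "T = \<int> \<or> T = UNIV" using assms by (simp add: ergodic_flow_def)
  then show "0 \<in> T" "\<And>s t. s \<in> T \<Longrightarrow> t \<in> T \<Longrightarrow> s + t \<in> T" "\<And>t. t \<in> T \<Longrightarrow> - t \<in> T" "closed T"
    by auto
  show "\<theta> t \<omega> \<in> space M" if "t \<in> T" "\<omega> \<in> space M" for t \<omega>
    using assms that measurable_space[of "\<theta> t" M M \<omega>] unfolding ergodic_flow_def by blast
qed (use assms in \<open>simp_all add: ergodic_flow_def\<close>)

locale random_dynamical_system = flow_on M T \<theta>
  for M :: "'w measure" and T :: "real set" and \<theta> :: "real \<Rightarrow> 'w \<Rightarrow> 'w" +
  fixes \<phi> :: "real \<Rightarrow> 'w \<Rightarrow> 'x::metric_space \<Rightarrow> 'x"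
  assumes cocycle: "t \<in> T \<Longrightarrow> s \<in> T \<Longrightarrow> \<omega> \<in> space M \<Longrightarrow> \<phi> (t + s) \<omega> x = \<phi> t (\<theta> s \<omega>) (\<phi> s \<omega> x)"
begin

text \<open>
  Forward invariance of \<open>U\<close> means that an orbit which has entered \<open>U\<close> stays there, so the basin
  consists of the points whose orbit lies in \<open>U\<close> at all late times. In this form the basin does
  not refer to the origin of time, whence its invariance.
\<close>

lemma mem_basin_iff:
  assumes U: "forward_invariant M T \<theta> \<phi> U" and \<omega>: "\<omega> \<in> space M"
  shows "x \<in> basin T \<theta> \<phi> U \<omega> \<longleftrightarrow> (\<exists>t\<in>T. \<forall>r\<in>T. t \<le> r \<longrightarrow> \<phi> r \<omega> x \<in> U (\<theta> r \<omega>))"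
proof
  assume "x \<in> basin T \<theta> \<phi> U \<omega>"
  then obtain t where t: "t \<in> T" "\<phi> t \<omega> x \<in> U (\<theta> t \<omega>)" by (auto simp: basin_def)
  have "\<phi> r \<omega> x \<in> U (\<theta> r \<omega>)" if r: "r \<in> T" "t \<le> r" for r
  proof -
    have "r - t \<in> T" using T_add[OF r(1) T_uminus[OF t(1)]] by simp
    then have "\<phi> (r - t) (\<theta> t \<omega>) (\<phi> t \<omega> x) \<in> U (\<theta> (r - t) (\<theta> t \<omega>))"
      using U t r \<theta>_space[OF t(1) \<omega>] unfolding forward_invariant_def by force
    then show ?thesis
      using cocycle[OF \<open>r - t \<in> T\<close> t(1) \<omega>] \<theta>_add[OF \<open>r - t \<in> T\<close> t(1) \<omega>] by simp
  qed
  then show "\<exists>t\<in>T. \<forall>r\<in>T. t \<le> r \<longrightarrow> \<phi> r \<omega> x \<in> U (\<theta> r \<omega>)" using t(1) by blast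
next
  assume "\<exists>t\<in>T. \<forall>r\<in>T. t \<le> r \<longrightarrow> \<phi> r \<omega> x \<in> U (\<theta> r \<omega>)"
  then obtain t where t: "t \<in> T" "\<And>r. r \<in> T \<Longrightarrow> t \<le> r \<Longrightarrow> \<phi> r \<omega> x \<in> U (\<theta> r \<omega>)" by blast
  then show "x \<in> basin T \<theta> \<phi> U \<omega>"
    unfolding basin_def using T_zero by (auto intro!: bexI[of _ "max 0 t"] simp: max_def)
qed

lemma basin_invariant:
  assumes U: "forward_invariant M T \<theta> \<phi> U" and \<omega>: "\<omega> \<in> space M" and s: "s \<in> T"
  shows "\<phi> s \<omega> x \<in> basin T \<theta> \<phi> U (\<theta> s \<omega>) \<longleftrightarrow> x \<in> basin T \<theta> \<phi> U \<omega>"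
proof -
  have shift: "\<phi> r (\<theta> s \<omega>) (\<phi> s \<omega> x) = \<phi> (r + s) \<omega> x" "\<theta> r (\<theta> s \<omega>) = \<theta> (r + s) \<omega>" if "r \<in> T" for r
    using cocycle[OF that s \<omega>] \<theta>_add[OF that s \<omega>] by simp_all
  have diff: "r - s \<in> T" if "r \<in> T" for r using T_add[OF that T_uminus[OF s]] by simp
  have "(\<exists>t\<in>T. \<forall>r\<in>T. t \<le> r \<longrightarrow> \<phi> (r + s) \<omega> x \<in> U (\<theta> (r + s) \<omega>))
    \<longleftrightarrow> (\<exists>t\<in>T. \<forall>r\<in>T. t \<le> r \<longrightarrow> \<phi> r \<omega> x \<in> U (\<theta> r \<omega>))" (is "?l \<longleftrightarrow> ?r")
  proof
    assume ?l
    then obtain t where t: "t \<in> T" "\<And>r. r \<in> T \<Longrightarrow> t \<le> r \<Longrightarrow> \<phi> (r + s) \<omega> x \<in> U (\<theta> (r + s) \<omega>)" by blast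
    show ?r
      using t(2)[OF diff] T_add[OF t(1) s] by (intro bexI[of _ "t + s"]) auto
  next
    assume ?r
    then obtain t where t: "t \<in> T" "\<And>r. r \<in> T \<Longrightarrow> t \<le> r \<Longrightarrow> \<phi> r \<omega> x \<in> U (\<theta> r \<omega>)" by blast
    show ?l
      using t(2)[OF T_add[OF _ s]] diff[OF t(1)] by (intro bexI[of _ "t - s"]) auto
  qed
  then show ?thesis
    by (simp add: mem_basin_iff[OF U \<omega>] mem_basin_iff[OF U \<theta>_space[OF s \<omega>]] shift)
qed

text \<open>
  The attractor is invariant by definition, and the repeller because it is the complement of a basin.
\<close>

lemma Morse_set_invariant:
  assumes "weak_Morse_decomposition M T \<theta> \<phi> \<M>" "D \<in> \<M>"
  shows "invariant M T \<theta> \<phi> D"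
proof -
  obtain n A R i where pairs: "\<And>i. i \<le> n \<Longrightarrow> weak_attractor_repeller_pair M T \<theta> \<phi> (A i) (R i)"
    and i: "i \<in> {1..n::nat}" and D: "D = (\<lambda>\<omega>. A i \<omega> \<inter> R (i - 1) \<omega>)"
    using assms unfolding weak_Morse_decomposition_def by blast
  have A: "\<phi> t \<omega> ` A i \<omega> = A i (\<theta> t \<omega>)" if "\<omega> \<in> space M" "t \<in> T" for \<omega> t
    using pairs[of i] i that
    by (simp add: weak_attractor_repeller_pair_def local_weak_attractor_def invariant_def)
  obtain U where U: "forward_invariant M T \<theta> \<phi> U"
    and R: "\<And>\<omega>. \<omega> \<in> space M \<Longrightarrow> R (i - 1) \<omega> = UNIV - basin T \<theta> \<phi> U \<omega>"
  proof -
    have "i - 1 \<le> n" using i by auto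
    from pairs[OF this] show thesis
      unfolding weak_attractor_repeller_pair_def attracting_nbhd_def by (blast intro: that)
  qed
  show ?thesis
    unfolding invariant_def
  proof (intro ballI)
    fix \<omega> t assume \<omega>: "\<omega> \<in> space M" and t: "t \<in> T"
    have "\<phi> t \<omega> x \<in> R (i - 1) (\<theta> t \<omega>) \<longleftrightarrow> x \<in> R (i - 1) \<omega>" for x
      unfolding R[OF \<omega>] R[OF \<theta>_space[OF t \<omega>]] using basin_invariant[OF U \<omega> t] by simp
    then show "\<phi> t \<omega> ` D \<omega> = D (\<theta> t \<omega>)"
      unfolding D A[OF \<omega> t, symmetric] by auto
  qed
qed

text \<open>
  For an invariant random set the fibre over \<open>\<omega>\<close> determines all the fibres over its orbit, so a
  single null set serves for all times.
\<close>

lemma invariant_AE_eq_orbit: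
  assumes "invariant M T \<theta> \<phi> D" "invariant M T \<theta> \<phi> E" "AE \<omega> in M. D \<omega> = E \<omega>"
  shows "AE \<omega> in M. \<forall>t\<in>T. D (\<theta> t \<omega>) = E (\<theta> t \<omega>)"
  using assms(3) AE_space
proof eventually_elim
  case (elim \<omega>)
  then show ?case using assms(1,2) unfolding invariant_def by metis
qed

end

section \<open>Linear cocycles and their conjugates\<close>

lemma linear_rds_invertible:
  assumes "flow_on M T \<theta>" and \<Phi>: "linear_rds M T \<theta> \<Phi>" and t: "t \<in> T" and \<omega>: "\<omega> \<in> space M"
  shows "invertible (\<Phi> t \<omega>)"
proof -
  interpret flow_on M T \<theta> by fact
  have "\<Phi> (- t) (\<theta> t \<omega>) ** \<Phi> t \<omega> = \<Phi> (- t + t) \<omega>"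
    using \<Phi> t \<omega> T_uminus unfolding linear_rds_def by metis
  moreover have "\<Phi> t (\<theta> (- t) (\<theta> t \<omega>)) ** \<Phi> (- t) (\<theta> t \<omega>) = \<Phi> (t + - t) (\<theta> t \<omega>)"
    using \<Phi> t \<theta>_space[OF t \<omega>] T_uminus unfolding linear_rds_def by metis
  moreover have "\<theta> (- t) (\<theta> t \<omega>) = \<omega>"
    using \<theta>_add[OF T_uminus[OF t] t \<omega>] by (simp add: \<theta>_zero \<omega>)
  ultimately show ?thesis
    using \<Phi> \<omega> \<theta>_space[OF t \<omega>] unfolding invertible_def linear_rds_def by auto
qed

lemma linear_rds_projectivisation:
  fixes \<Phi> :: "real \<Rightarrow> 'w \<Rightarrow> real ^ 'd ^ 'd"
  assumes "flow_on M T \<theta>" and \<Phi>: "linear_rds M T \<theta> \<Phi>"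
  shows "random_dynamical_system M T \<theta> (projectivisation \<Phi>)"
proof -
  interpret flow_on M T \<theta> by fact
  show ?thesis
  proof
    fix t s \<omega> and p :: "'d proj" assume *: "t \<in> T" "s \<in> T" "\<omega> \<in> space M"
    obtain x where x: "norm x = 1" "p = abs_proj x" by (rule abs_proj_cases)
    then have nz: "x \<noteq> 0" by auto
    note inv = linear_rds_invertible[OF assms]
    have "\<Phi> (t + s) \<omega> = \<Phi> t (\<theta> s \<omega>) ** \<Phi> s \<omega>" using \<Phi> * by (simp add: linear_rds_def)
    then show "projectivisation \<Phi> (t + s) \<omega> p = projectivisation \<Phi> t (\<theta> s \<omega>) (projectivisation \<Phi> s \<omega> p)"
      using * nz inv[of s \<omega>] inv[of t "\<theta> s \<omega>"] inv[of "t + s" \<omega>] \<theta>_space T_add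
      by (simp add: projectivisation_def x proj_map_abs_proj invertible_mult_nonzero matrix_vector_mul_assoc)
  qed
qed

lemma linear_rds_conjugate_system:
  fixes \<Phi> :: "real \<Rightarrow> 'w \<Rightarrow> real ^ 'd ^ 'd"
  assumes "flow_on M T \<theta>" and \<theta>_meas: "\<And>t. t \<in> T \<Longrightarrow> \<theta> t \<in> M \<rightarrow>\<^sub>M M"
    and \<Phi>: "linear_rds M T \<theta> \<Phi>"
    and H_inv: "\<And>\<omega>. \<omega> \<in> space M \<Longrightarrow> invertible (H \<omega>)"
    and H_meas: "H \<in> borel_measurable M"
    and H_cont: "\<And>\<omega>. \<omega> \<in> space M \<Longrightarrow> continuous_on T (\<lambda>t. H (\<theta> t \<omega>))"
  shows "linear_rds M T \<theta> (conjugate_system \<theta> H \<Phi>)"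
  unfolding linear_rds_def
proof (intro conjI ballI)
  interpret flow_on M T \<theta> by fact
  have apply_eq: "conjugate_system \<theta> H \<Phi> t \<omega> *v x = H (\<theta> t \<omega>) *v (\<Phi> t \<omega> *v (matrix_inv (H \<omega>) *v x))" for t \<omega> x
    by (simp add: conjugate_system_def matrix_vector_mul_assoc matrix_mul_assoc)
  let ?T = "restrict_space borel T"
  obtain C where C: "countable C" "C \<subseteq> T" "T \<subseteq> closure C" by (rule separable)
  have H_flow: "(\<lambda>(t, \<omega>). H (\<theta> t \<omega>)) \<in> borel_measurable (?T \<Otimes>\<^sub>M M)"
    by (rule caratheodory_measurable[OF C]) (auto intro: H_cont measurable_compose[OF \<theta>_meas H_meas])
  have inv_part: "(\<lambda>z. matrix_inv (H (fst (snd z))) *v snd (snd z)) \<in> borel_measurable (?T \<Otimes>\<^sub>M M \<Otimes>\<^sub>M borel)"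
    by (intro borel_measurable_matrix_vector_mult measurable_compose[OF _ borel_measurable_matrix_inv[OF H_meas H_inv]])
      measurable
  have "(\<lambda>z. (fst z, fst (snd z), matrix_inv (H (fst (snd z))) *v snd (snd z)))
      \<in> ?T \<Otimes>\<^sub>M M \<Otimes>\<^sub>M borel \<rightarrow>\<^sub>M ?T \<Otimes>\<^sub>M M \<Otimes>\<^sub>M borel"
    using inv_part by measurable
  moreover have "(\<lambda>(t, \<omega>, x). \<Phi> t \<omega> *v x) \<in> borel_measurable (?T \<Otimes>\<^sub>M M \<Otimes>\<^sub>M borel)"
    using \<Phi> by (simp add: linear_rds_def)
  ultimately have mid: "(\<lambda>z. \<Phi> (fst z) (fst (snd z)) *v (matrix_inv (H (fst (snd z))) *v snd (snd z)))
      \<in> borel_measurable (?T \<Otimes>\<^sub>M M \<Otimes>\<^sub>M borel)"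
    by (rule measurable_compose[THEN measurable_cong[THEN iffD1, rotated]]) simp
  have "(\<lambda>z. (fst z, fst (snd z))) \<in> ?T \<Otimes>\<^sub>M M \<Otimes>\<^sub>M borel \<rightarrow>\<^sub>M ?T \<Otimes>\<^sub>M M" by measurable
  then have "(\<lambda>z. H (\<theta> (fst z) (fst (snd z)))) \<in> borel_measurable (?T \<Otimes>\<^sub>M M \<Otimes>\<^sub>M borel)"
    using H_flow by (rule measurable_compose[THEN measurable_cong[THEN iffD1, rotated]]) simp
  from borel_measurable_matrix_vector_mult[OF this mid]
  show "(\<lambda>(t, \<omega>, x). conjugate_system \<theta> H \<Phi> t \<omega> *v x) \<in> borel_measurable (?T \<Otimes>\<^sub>M M \<Otimes>\<^sub>M borel)"
    by (simp add: apply_eq case_prod_beta)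
next
  interpret flow_on M T \<theta> by fact
  fix \<omega> assume \<omega>: "\<omega> \<in> space M"
  show "conjugate_system \<theta> H \<Phi> 0 \<omega> = mat 1"
    using \<Phi> \<omega> by (simp add: conjugate_system_def linear_rds_def \<theta>_zero matrix_inv_invertible H_inv)
  show "conjugate_system \<theta> H \<Phi> (t + s) \<omega> =
      conjugate_system \<theta> H \<Phi> t (\<theta> s \<omega>) ** conjugate_system \<theta> H \<Phi> s \<omega>" if "t \<in> T" "s \<in> T" for t s
  proof -
    have "conjugate_system \<theta> H \<Phi> t (\<theta> s \<omega>) ** conjugate_system \<theta> H \<Phi> s \<omega> =
        H (\<theta> t (\<theta> s \<omega>)) ** \<Phi> t (\<theta> s \<omega>) ** (matrix_inv (H (\<theta> s \<omega>)) ** H (\<theta> s \<omega>)) ** \<Phi> s \<omega> ** matrix_inv (H \<omega>)"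
      by (simp add: conjugate_system_def matrix_mul_assoc)
    also have "\<dots> = H (\<theta> t (\<theta> s \<omega>)) ** (\<Phi> t (\<theta> s \<omega>) ** \<Phi> s \<omega>) ** matrix_inv (H \<omega>)"
      using \<theta>_space[OF that(2) \<omega>] by (simp add: matrix_inv_invertible H_inv matrix_mul_assoc)
    also have "\<dots> = conjugate_system \<theta> H \<Phi> (t + s) \<omega>"
      using \<Phi> \<omega> that by (simp add: conjugate_system_def linear_rds_def \<theta>_add)
    finally show ?thesis ..
  qed
  have \<Phi>_cont: "continuous_on (T \<times> UNIV) (\<lambda>(t, x). \<Phi> t \<omega> *v x)"
    using \<Phi> \<omega> by (simp add: linear_rds_def)
  have "continuous_on (T \<times> UNIV) (\<lambda>z. (fst z, matrix_inv (H \<omega>) *v snd z))"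
    by (intro continuous_intros bounded_linear.continuous_on[OF matrix_vector_mul_bounded_linear])
  then have "continuous_on (T \<times> UNIV) (\<lambda>z. case (fst z, matrix_inv (H \<omega>) *v snd z) of (t, x) \<Rightarrow> \<Phi> t \<omega> *v x)"
    by (rule continuous_on_compose2[OF \<Phi>_cont]) auto
  moreover have "continuous_on (T \<times> UNIV) (\<lambda>z :: real \<times> (real ^ 'd). H (\<theta> (fst z) \<omega>))"
    by (rule continuous_on_compose2[OF H_cont[OF \<omega>]]) (auto intro: continuous_intros)
  ultimately have "continuous_on (T \<times> UNIV) (\<lambda>z. H (\<theta> (fst z) \<omega>) *v
      (case (fst z, matrix_inv (H \<omega>) *v snd z) of (t, x) \<Rightarrow> \<Phi> t \<omega> *v x))"
    by (intro bounded_bilinear.continuous_on[OF bounded_bilinear_matrix_vector_mult])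
  then show "continuous_on (T \<times> UNIV) (\<lambda>(t, x). conjugate_system \<theta> H \<Phi> t \<omega> *v x)"
    by (simp add: conjugate_system_def case_prod_beta matrix_vector_mul_assoc[symmetric])
qed


section \<open>Distortion along an orbit and the Morse spectrum\<close>

lemma matrix_vector_expansion_le:
  fixes A :: "real ^ 'd ^ 'd"
  assumes "invertible A" "x \<noteq> 0" "norm (A *v x) \<le> b * norm x"
  shows "ln (norm (A *v x) / norm x) \<le> ln b"
proof -
  have "0 < norm (A *v x) / norm x"
    using assms by (simp add: invertible_mult_nonzero)
  moreover have "norm (A *v x) / norm x \<le> b"
    using assms by (simp add: field_simps)
  ultimately show ?thesis by (intro ln_mono) auto
qed

text \<open>
  Outside a bounded time interval temperedness bounds the logarithm of the operator norm by
  \<open>\<epsilon> * \<bar>t\<bar>\<close>; inside it continuity bounds the matrices themselves, which supplies the constant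
  \<open>C\<close>.
\<close>

lemma tempered_orbit_upper_bound:
  fixes G :: "real \<Rightarrow> real ^ 'd ^ 'd"
  assumes T: "closed T" and cont: "continuous_on T G"
    and inv: "\<And>t. t \<in> T \<Longrightarrow> invertible (G t)"
    and top: "((\<lambda>t. 1 / \<bar>t\<bar> * ln (onorm ((*v) (G t)))) \<longlongrightarrow> 0) (inf at_top (principal T))"
    and bot: "((\<lambda>t. 1 / \<bar>t\<bar> * ln (onorm ((*v) (G t)))) \<longlongrightarrow> 0) (inf at_bot (principal T))"
    and \<epsilon>: "0 < \<epsilon>"
  obtains C where "\<And>t x. t \<in> T \<Longrightarrow> x \<noteq> 0 \<Longrightarrow> ln (norm (G t *v x) / norm x) \<le> C + \<epsilon> * \<bar>t\<bar>"
proof -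
  have "\<forall>\<^sub>F t in at_top. t \<in> T \<longrightarrow> 1 / \<bar>t\<bar> * ln (onorm ((*v) (G t))) < \<epsilon>"
    using order_tendstoD(2)[OF top \<epsilon>] by (simp add: eventually_inf_principal)
  then obtain a where a: "\<And>t. a \<le> t \<Longrightarrow> t \<in> T \<Longrightarrow> 1 / \<bar>t\<bar> * ln (onorm ((*v) (G t))) < \<epsilon>"
    by (auto simp: eventually_at_top_linorder)
  have "\<forall>\<^sub>F t in at_bot. t \<in> T \<longrightarrow> 1 / \<bar>t\<bar> * ln (onorm ((*v) (G t))) < \<epsilon>"
    using order_tendstoD(2)[OF bot \<epsilon>] by (simp add: eventually_inf_principal)
  then obtain b where b: "\<And>t. t \<le> b \<Longrightarrow> t \<in> T \<Longrightarrow> 1 / \<bar>t\<bar> * ln (onorm ((*v) (G t))) < \<epsilon>"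
    by (auto simp: eventually_at_bot_linorder)
  define S where "S = \<bar>a\<bar> + \<bar>b\<bar> + 1"
  have "compact (G ` (T \<inter> {- S..S}))"
    by (intro compact_continuous_image continuous_on_subset[OF cont] closed_Int_compact T) auto
  then obtain B where B: "\<And>t. t \<in> T \<Longrightarrow> \<bar>t\<bar> \<le> S \<Longrightarrow> norm (G t) \<le> B"
    using bounded_iff[of "G ` (T \<inter> {- S..S})"] compact_imp_bounded by (fastforce simp: abs_le_iff)
  show thesis
  proof (rule that)
    fix t and x :: "real ^ 'd" assume t: "t \<in> T" and x: "x \<noteq> 0"
    show "ln (norm (G t *v x) / norm x) \<le> ln (max 1 B) + \<epsilon> * \<bar>t\<bar>"
    proof (cases "\<bar>t\<bar> \<le> S")
      case True
      have "norm (G t *v x) \<le> max 1 B * norm x"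
        using norm_matrix_vector_mult_le[of "G t" x] B[OF t True]
        by (elim order_trans) (intro mult_right_mono, auto)
      from matrix_vector_expansion_le[OF inv[OF t] x this]
      show ?thesis using \<epsilon> by (simp add: add_increasing2)
    next
      case False
      then have pos: "0 < \<bar>t\<bar>" and "a \<le> t \<or> t \<le> b" by (auto simp: S_def)
      then have "1 / \<bar>t\<bar> * ln (onorm ((*v) (G t))) < \<epsilon>" using a b t by blast
      then have "ln (onorm ((*v) (G t))) \<le> \<epsilon> * \<bar>t\<bar>" using pos by (simp add: field_simps)
      moreover have "ln (norm (G t *v x) / norm x) \<le> ln (onorm ((*v) (G t)))"
        using onorm[OF matrix_vector_mul_bounded_linear, of "G t" x]
        by (rule matrix_vector_expansion_le[OF inv[OF t] x])
      moreover have "0 \<le> ln (max 1 B)" by simp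
      ultimately show ?thesis by linarith
    qed
  qed
qed

text \<open>
  Temperedness made uniform over all times, bounded ones included, and over all vectors. This is the
  form in which it enters the exponents: the times \<open>t\<close> in the definition of the spectrum may stay
  bounded, where the limits say nothing.
\<close>

definition subexponential_distortion :: "real set \<Rightarrow> (real \<Rightarrow> real ^ 'd ^ 'd) \<Rightarrow> bool" where
  "subexponential_distortion T G \<longleftrightarrow>
     (\<forall>\<epsilon>>0. \<exists>C. \<forall>t\<in>T. \<forall>x. x \<noteq> 0 \<longrightarrow> \<bar>ln (norm (G t *v x) / norm x)\<bar> \<le> C + \<epsilon> * \<bar>t\<bar>)"

lemma ln_expansion_matrix_inv:
  fixes A :: "real ^ 'd ^ 'd"
  assumes "invertible A" "x \<noteq> 0"
  shows "ln (norm (matrix_inv A *v (A *v x)) / norm (A *v x)) = - ln (norm (A *v x) / norm x)"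
  using assms by (simp add: matrix_inv_invertible invertible_mult_nonzero ln_div)

lemma subexponential_distortion_matrix_inv:
  assumes "subexponential_distortion T G" and inv: "\<And>t. t \<in> T \<Longrightarrow> invertible (G t)"
  shows "subexponential_distortion T (\<lambda>t. matrix_inv (G t))"
  unfolding subexponential_distortion_def
proof (intro allI impI)
  fix \<epsilon> :: real assume "0 < \<epsilon>"
  then obtain C where C: "\<And>t x. t \<in> T \<Longrightarrow> x \<noteq> 0 \<Longrightarrow> \<bar>ln (norm (G t *v x) / norm x)\<bar> \<le> C + \<epsilon> * \<bar>t\<bar>"
    using assms(1) unfolding subexponential_distortion_def by blast
  have "\<bar>ln (norm (matrix_inv (G t) *v y) / norm y)\<bar> \<le> C + \<epsilon> * \<bar>t\<bar>" if "t \<in> T" "y \<noteq> 0" for t y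
  proof -
    define x where "x = matrix_inv (G t) *v y"
    have x: "x \<noteq> 0" "y = G t *v x"
      using inv[OF that(1)] that(2) by (simp_all add: x_def matrix_inv_invertible invertible_mult_nonzero)
    show ?thesis
      using C[OF that(1) x(1)] ln_expansion_matrix_inv[OF inv[OF that(1)] x(1)] by (simp add: x(2))
  qed
  then show "\<exists>C. \<forall>t\<in>T. \<forall>x. x \<noteq> 0 \<longrightarrow> \<bar>ln (norm (matrix_inv (G t) *v x) / norm x)\<bar> \<le> C + \<epsilon> * \<bar>t\<bar>"
    by blast
qed

text \<open>
  The lower bound on \<open>\<parallel>G t x\<parallel> / \<parallel>x\<parallel>\<close> is the upper bound for the inverse matrix at \<open>G t x\<close>.
\<close>

lemma tempered_imp_subexponential_distortion:
  fixes G :: "real \<Rightarrow> real ^ 'd ^ 'd"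
  assumes T: "closed T" and cont: "continuous_on T G"
    and inv: "\<And>t. t \<in> T \<Longrightarrow> invertible (G t)"
    and limits:
      "((\<lambda>t. 1 / \<bar>t\<bar> * ln (onorm ((*v) (G t)))) \<longlongrightarrow> 0) (inf at_top (principal T))"
      "((\<lambda>t. 1 / \<bar>t\<bar> * ln (onorm ((*v) (G t)))) \<longlongrightarrow> 0) (inf at_bot (principal T))"
      "((\<lambda>t. 1 / \<bar>t\<bar> * ln (onorm ((*v) (matrix_inv (G t))))) \<longlongrightarrow> 0) (inf at_top (principal T))"
      "((\<lambda>t. 1 / \<bar>t\<bar> * ln (onorm ((*v) (matrix_inv (G t))))) \<longlongrightarrow> 0) (inf at_bot (principal T))"
  shows "subexponential_distortion T G"
  unfolding subexponential_distortion_def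
proof (intro allI impI)
  fix \<epsilon> :: real assume \<epsilon>: "0 < \<epsilon>"
  obtain C1 where C1: "\<And>t x. t \<in> T \<Longrightarrow> x \<noteq> 0 \<Longrightarrow> ln (norm (G t *v x) / norm x) \<le> C1 + \<epsilon> * \<bar>t\<bar>"
    using tempered_orbit_upper_bound[OF T cont inv limits(1,2) \<epsilon>] by blast
  obtain C2 where C2: "\<And>t x. t \<in> T \<Longrightarrow> x \<noteq> 0 \<Longrightarrow> ln (norm (matrix_inv (G t) *v x) / norm x) \<le> C2 + \<epsilon> * \<bar>t\<bar>"
    using tempered_orbit_upper_bound[OF T continuous_on_matrix_inv[OF cont inv] matrix_inv_invertible(5)[OF inv] limits(3,4) \<epsilon>]
    by blast
  have "\<bar>ln (norm (G t *v x) / norm x)\<bar> \<le> max C1 C2 + \<epsilon> * \<bar>t\<bar>" if "t \<in> T" "x \<noteq> 0" for t x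
    using C1[OF that] C2[OF that(1) invertible_mult_nonzero[OF inv[OF that(1)] that(2)]]
      ln_expansion_matrix_inv[OF inv[OF that(1)] that(2)] by linarith
  then show "\<exists>C. \<forall>t\<in>T. \<forall>x. x \<noteq> 0 \<longrightarrow> \<bar>ln (norm (G t *v x) / norm x)\<bar> \<le> C + \<epsilon> * \<bar>t\<bar>" by blast
qed

text \<open>
  Given a sequence \<open>(\<tau>, t, x)\<close> realising a value for \<open>\<Phi>\<close>, the sequence \<open>(\<tau>, t, G (\<theta> t \<omega>) x)\<close> realises
  the same value for \<open>\<Psi>\<close>: the exponents differ by the distortions of \<open>G\<close> at the times \<open>\<tau> + t\<close> and
  \<open>t\<close>, divided by \<open>\<tau>\<close>, and both times are at most \<open>2 \<tau>\<close> in absolute value. The statement is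
  symmetric under replacing \<open>G\<close> by its inverse, so it yields both inclusions between the spectra.
\<close>

lemma Morse_spectrum_of_conjugate_subset:
  fixes \<Phi> \<Psi> :: "real \<Rightarrow> 'w \<Rightarrow> real ^ 'd ^ 'd" and G :: "'w \<Rightarrow> real ^ 'd ^ 'd"
  assumes "flow_on M T \<theta>" and \<omega>: "\<omega> \<in> space M"
    and G_inv: "\<And>t. t \<in> T \<Longrightarrow> invertible (G (\<theta> t \<omega>))"
    and \<Phi>_inv: "\<And>s t. s \<in> T \<Longrightarrow> t \<in> T \<Longrightarrow> invertible (\<Phi> s (\<theta> t \<omega>))"
    and sub: "subexponential_distortion T (\<lambda>t. G (\<theta> t \<omega>))"
    and conj: "\<And>s t x. s \<in> T \<Longrightarrow> t \<in> T \<Longrightarrow>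
      \<Psi> s (\<theta> t \<omega>) *v (G (\<theta> t \<omega>) *v x) = G (\<theta> (s + t) \<omega>) *v (\<Phi> s (\<theta> t \<omega>) *v x)"
    and VW: "\<And>t x. t \<in> T \<Longrightarrow> x \<in> V (\<theta> t \<omega>) \<Longrightarrow> G (\<theta> t \<omega>) *v x \<in> W (\<theta> t \<omega>)"
  shows "Morse_spectrum_of T \<theta> \<Phi> V \<omega> \<subseteq> Morse_spectrum_of T \<theta> \<Psi> W \<omega>"
proof
  interpret flow_on M T \<theta> by fact
  fix \<xi> assume "\<xi> \<in> Morse_spectrum_of T \<theta> \<Phi> V \<omega>"
  then obtain \<tau> t :: "nat \<Rightarrow> real" and x where
    T: "\<And>k. \<tau> k \<in> T" "\<And>k. t k \<in> T" and t_le: "\<And>k. \<bar>t k\<bar> \<le> \<bar>\<tau> k\<bar>"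
    and x: "\<And>k. x k \<in> V (\<theta> (t k) \<omega>)" "\<And>k. x k \<noteq> 0"
    and \<tau>: "filterlim \<tau> at_top sequentially"
    and lim: "(\<lambda>k. ereal (finite_time_exponent \<Phi> (\<tau> k) (\<theta> (t k) \<omega>) (x k))) \<longlonglongrightarrow> \<xi>"
    unfolding Morse_spectrum_of_def by blast
  define y where "y k = G (\<theta> (t k) \<omega>) *v x k" for k
  define z where "z k = \<Phi> (\<tau> k) (\<theta> (t k) \<omega>) *v x k" for k
  define g where "g s v = ln (norm (G (\<theta> s \<omega>) *v v) / norm v)" for s v
  define a where "a k = finite_time_exponent \<Phi> (\<tau> k) (\<theta> (t k) \<omega>) (x k)" for k
  define b where "b k = finite_time_exponent \<Psi> (\<tau> k) (\<theta> (t k) \<omega>) (y k)" for k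
  have nz: "y k \<noteq> 0" "z k \<noteq> 0" "G (\<theta> (\<tau> k + t k) \<omega>) *v z k \<noteq> 0" for k
    using x(2) T G_inv \<Phi>_inv T_add by (simp_all add: y_def z_def invertible_mult_nonzero)
  have diff: "b k - a k = 1 / \<tau> k * (g (\<tau> k + t k) (z k) - g (t k) (x k))" for k
  proof -
    have "b k = 1 / \<tau> k * ln (norm (G (\<theta> (\<tau> k + t k) \<omega>) *v z k) / norm (y k))"
      using conj[OF T(1,2)] by (simp add: b_def finite_time_exponent_def y_def z_def)
    then show ?thesis
      using nz[of k] x(2)[of k]
      by (simp add: a_def finite_time_exponent_def g_def ln_div y_def[symmetric] z_def[symmetric] algebra_simps)
  qed
  have "(\<lambda>k. b k - a k) \<longlonglongrightarrow> 0"
  proof (rule tendstoI)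
    fix r :: real assume r: "0 < r"
    then obtain C where C: "\<And>s v. s \<in> T \<Longrightarrow> v \<noteq> 0 \<Longrightarrow> \<bar>g s v\<bar> \<le> C + (r / 6) * \<bar>s\<bar>"
      \<comment> \<open>The two times add up to at most \<open>3 \<tau>\<close>, so the slope \<open>r/6\<close> uses up half of \<open>r\<close>.\<close>
      using sub unfolding subexponential_distortion_def g_def
      by (metis divide_pos_pos zero_less_numeral)
    \<comment> \<open>The other half has to dominate \<open>2 C / \<tau>\<close>, strictly.\<close>
    have "\<forall>\<^sub>F k in sequentially. max 1 (5 * \<bar>C\<bar> / r) \<le> \<tau> k"
      using \<tau> unfolding filterlim_at_top by blast
    then show "\<forall>\<^sub>F k in sequentially. dist (b k - a k) 0 < r"
    proof eventually_elim
      case (elim k)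
      then have pos: "0 < \<tau> k" and large: "5 * \<bar>C\<bar> \<le> r * \<tau> k"
        using r by (auto simp: field_simps)
      have "\<bar>\<tau> k + t k\<bar> \<le> 2 * \<tau> k" "\<bar>t k\<bar> \<le> \<tau> k" using t_le[of k] pos by auto
      then have "r / 6 * \<bar>\<tau> k + t k\<bar> \<le> r / 6 * (2 * \<tau> k)" "r / 6 * \<bar>t k\<bar> \<le> r / 6 * \<tau> k"
        using r by (auto intro!: mult_left_mono)
      then have "\<bar>g (\<tau> k + t k) (z k) - g (t k) (x k)\<bar> \<le> 2 * C + r / 2 * \<tau> k"
        using C[OF T_add[OF T(1,2)] nz(2)[of k], of k k] C[OF T(2) x(2)[of k], of k] by linarith
      also have "\<dots> < r * \<tau> k"
        using large mult_pos_pos[OF r pos] by linarith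
      finally have "\<bar>g (\<tau> k + t k) (z k) - g (t k) (x k)\<bar> / \<tau> k < r"
        using pos by (simp add: field_simps)
      then show ?case using pos by (simp add: diff dist_real_def abs_mult)
    qed
  qed
  then have "(\<lambda>k. ereal (b k - a k)) \<longlonglongrightarrow> 0" by (simp add: zero_ereal_def)
  from tendsto_add_ereal_general2[OF _ this lim[folded a_def]]
  have "(\<lambda>k. ereal (b k)) \<longlonglongrightarrow> \<xi>" by (simp add: add.commute)
  moreover have "y k \<in> W (\<theta> (t k) \<omega>) - {0}" for k using VW[OF T(2) x(1)] nz(1) by (simp add: y_def)
  ultimately show "\<xi> \<in> Morse_spectrum_of T \<theta> \<Psi> W \<omega>"
    unfolding Morse_spectrum_of_def b_def using T t_le \<tau> by blast
qed

lemma mem_proj_preimage_image: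
  assumes "invertible A" "x \<in> proj_preimage D"
  shows "A *v x \<in> proj_preimage (proj_map A ` D)"
  using assms invertible_mult_nonzero[OF assms(1)] proj_map_abs_proj[OF assms(1)]
  unfolding proj_preimage_def by (auto intro!: image_eqI)


section \<open>The conjugacy induced by a random invertible matrix\<close>

text \<open>
  \<open>H\<close> is replaced by the identity outside \<open>space M\<close>, so that \<open>\<bbbP>G(\<omega>)\<close> is bijective for every
  \<open>\<omega>\<close>.
\<close>

lemma random_conjugacy_projectivisation:
  fixes \<Phi> :: "real \<Rightarrow> 'w \<Rightarrow> real ^ 'd ^ 'd"
  assumes flow: "ergodic_flow M T d \<theta>"
    and \<Phi>: "linear_rds M T \<theta> \<Phi>" and \<Psi>: "linear_rds M T \<theta> (conjugate_system \<theta> H \<Phi>)"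
    and H_inv: "\<And>\<omega>. \<omega> \<in> space M \<Longrightarrow> invertible (H \<omega>)"
    and H_meas: "H \<in> borel_measurable M"
  defines "G \<equiv> \<lambda>\<omega>. if \<omega> \<in> space M then H \<omega> else mat 1"
  shows "random_conjugacy M T \<theta> (projectivisation \<Phi>) (projectivisation (conjugate_system \<theta> H \<Phi>))
    (\<lambda>\<omega>. proj_map (G \<omega>)) (\<lambda>\<omega>. 2 * norm (G \<omega>) * norm (matrix_inv (G \<omega>)))"
proof -
  interpret flow_on M T \<theta> by (rule ergodic_flow_imp_flow_on[OF flow])
  interpret prob_space M using flow by (simp add: ergodic_flow_def)
  have G_inv: "invertible (G \<omega>)" for \<omega>
    using H_inv by (auto simp: G_def invertible_def intro: exI[of _ "mat 1"])
  have G_meas: "G \<in> borel_measurable M"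
    using H_meas by (rule measurable_cong[THEN iffD1, rotated]) (simp add: G_def)
  note Gi_meas = borel_measurable_matrix_inv[OF G_meas G_inv]
  show ?thesis
  proof
    show "\<theta> t \<in> M \<rightarrow>\<^sub>M M" "distr M M (\<theta> t) = M" if "t \<in> T" for t
      using flow that unfolding ergodic_flow_def by blast+
    show "bij (proj_map (G \<omega>))" for \<omega> by (rule bij_proj_map[OF G_inv])
    show "(\<lambda>(p, \<omega>). proj_map (G \<omega>) p) \<in> borel_measurable (borel \<Otimes>\<^sub>M M)"
      by (rule borel_measurable_proj_map[OF G_meas G_inv])
    show "(\<lambda>(p, \<omega>). inv (proj_map (G \<omega>)) p) \<in> borel_measurable (borel \<Otimes>\<^sub>M M)"
      unfolding bij_proj_map(2)[OF G_inv]
      by (rule borel_measurable_proj_map[OF Gi_meas matrix_inv_invertible(5)[OF G_inv]])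
    show "(\<lambda>\<omega>. 2 * norm (G \<omega>) * norm (matrix_inv (G \<omega>))) \<in> borel_measurable M"
      using G_meas Gi_meas by measurable
    show "dist (proj_map (G \<omega>) p) (proj_map (G \<omega>) q) \<le> 2 * norm (G \<omega>) * norm (matrix_inv (G \<omega>)) * dist p q" for \<omega> p q
      by (rule dist_proj_map_le[OF G_inv])
    show "dist (inv (proj_map (G \<omega>)) p) (inv (proj_map (G \<omega>)) q) \<le> 2 * norm (G \<omega>) * norm (matrix_inv (G \<omega>)) * dist p q" for \<omega> p q
      using dist_proj_map_le[OF matrix_inv_invertible(5)[OF G_inv], of \<omega> p q]
      by (simp add: bij_proj_map(2)[OF G_inv] matrix_inv_invertible(6)[OF G_inv] mult_ac)
    fix \<omega> t and p :: "'d proj" assume \<omega>: "\<omega> \<in> space M" and t: "t \<in> T"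
    obtain x where x: "norm x = 1" "p = abs_proj x" by (rule abs_proj_cases)
    then have nz: "x \<noteq> 0" by auto
    show "projectivisation (conjugate_system \<theta> H \<Phi>) t \<omega> (proj_map (G \<omega>) p) =
        proj_map (G (\<theta> t \<omega>)) (projectivisation \<Phi> t \<omega> p)"
      using nz \<omega> \<theta>_space[OF t \<omega>] H_inv linear_rds_invertible[OF flow_on_axioms \<Phi> t \<omega>]
        linear_rds_invertible[OF flow_on_axioms \<Psi> t \<omega>]
      by (simp add: projectivisation_def x(2) proj_map_abs_proj invertible_mult_nonzero G_def
          conjugate_system_def matrix_vector_mul_assoc[symmetric] matrix_inv_invertible)
  qed
qed

theorem proposition3p15:
  fixes M :: "'w measure" and T :: "real set" and d\<^sub>\<Omega> :: "'w \<Rightarrow> 'w \<Rightarrow> real"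
    and \<theta> :: "real \<Rightarrow> 'w \<Rightarrow> 'w" and \<Phi> :: "real \<Rightarrow> 'w \<Rightarrow> real ^ 'd ^ 'd"
    and H :: "'w \<Rightarrow> real ^ 'd ^ 'd"
  assumes flow: "ergodic_flow M T d\<^sub>\<Omega> \<theta>"
    and rds: "linear_rds M T \<theta> \<Phi>"
    and H_invertible: "\<And>\<omega>. \<omega> \<in> space M \<Longrightarrow> invertible (H \<omega>)"
    and H_measurable: "H \<in> borel_measurable M"
    and H_continuous: "\<And>\<omega>. \<omega> \<in> space M \<Longrightarrow> continuous_on T (\<lambda>t. H (\<theta> t \<omega>))"
    and H_tempered: "tempered M T \<theta> (\<lambda>\<omega>. onorm (\<lambda>x. H \<omega> *v x))"
    and H_inv_tempered: "tempered M T \<theta> (\<lambda>\<omega>. onorm (\<lambda>x. matrix_inv (H \<omega>) *v x))"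
  shows "linear_rds M T \<theta> (conjugate_system \<theta> H \<Phi>) \<and>
    (\<forall>\<Xi>\<^sub>\<Phi> \<Xi>\<^sub>\<Psi>. is_weak_Morse_spectrum M T \<theta> \<Phi> \<Xi>\<^sub>\<Phi> \<longrightarrow>
       is_weak_Morse_spectrum M T \<theta> (conjugate_system \<theta> H \<Phi>) \<Xi>\<^sub>\<Psi> \<longrightarrow>
       (AE \<omega> in M. \<Xi>\<^sub>\<Psi> \<omega> = \<Xi>\<^sub>\<Phi> \<omega>))"
proof (intro conjI allI impI)
  interpret flow_on M T \<theta> by (rule ergodic_flow_imp_flow_on[OF flow])
  have \<theta>_meas: "\<theta> t \<in> M \<rightarrow>\<^sub>M M" if "t \<in> T" for t
    using flow that unfolding ergodic_flow_def by blast
  let ?\<Psi> = "conjugate_system \<theta> H \<Phi>"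
  show \<Psi>: "linear_rds M T \<theta> ?\<Psi>"
    by (rule linear_rds_conjugate_system[OF flow_on_axioms \<theta>_meas rds H_invertible H_measurable H_continuous])
  fix \<Xi>\<^sub>\<Phi> \<Xi>\<^sub>\<Psi>
  assume \<Phi>_spectrum: "is_weak_Morse_spectrum M T \<theta> \<Phi> \<Xi>\<^sub>\<Phi>"
    and \<Psi>_spectrum: "is_weak_Morse_spectrum M T \<theta> ?\<Psi> \<Xi>\<^sub>\<Psi>"
  obtain \<M> where
    \<M>: "the_finest_weak_Morse_decomposition M T \<theta> (projectivisation \<Phi>) \<M>" and
    \<Xi>\<^sub>\<Phi>: "\<And>\<omega>. \<omega> \<in> space M \<Longrightarrow> \<Xi>\<^sub>\<Phi> \<omega> = (\<Union>D\<in>\<M>. Morse_spectrum_of T \<theta> \<Phi> (\<lambda>\<omega>'. proj_preimage (D \<omega>')) \<omega>)"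
    using \<Phi>_spectrum unfolding is_weak_Morse_spectrum_def by auto
  obtain \<N> where
    \<N>: "the_finest_weak_Morse_decomposition M T \<theta> (projectivisation ?\<Psi>) \<N>" and
    \<Xi>\<^sub>\<Psi>: "\<And>\<omega>. \<omega> \<in> space M \<Longrightarrow> \<Xi>\<^sub>\<Psi> \<omega> = (\<Union>D\<in>\<N>. Morse_spectrum_of T \<theta> ?\<Psi> (\<lambda>\<omega>'. proj_preimage (D \<omega>')) \<omega>)"
    using \<Psi>_spectrum unfolding is_weak_Morse_spectrum_def by auto
  define G where "G \<omega> = (if \<omega> \<in> space M then H \<omega> else mat 1)" for \<omega>
  define h where "h \<omega> = proj_map (G \<omega>)" for \<omega>
  define L where "L \<omega> = 2 * norm (G \<omega>) * norm (matrix_inv (G \<omega>))" for \<omega>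
  interpret conjugacy: random_conjugacy M T \<theta> "projectivisation \<Phi>" "projectivisation ?\<Psi>" h L
    unfolding h_def[abs_def] L_def[abs_def] G_def[abs_def]
    by (rule random_conjugacy_projectivisation[OF flow rds \<Psi> H_invertible H_measurable])
  interpret \<Psi>: random_dynamical_system M T \<theta> "projectivisation ?\<Psi>"
    by (rule linear_rds_projectivisation[OF flow_on_axioms \<Psi>])
  have dec: "weak_Morse_decomposition M T \<theta> (projectivisation \<Phi>) \<M>"
    "weak_Morse_decomposition M T \<theta> (projectivisation ?\<Psi>) \<N>"
    using \<M> \<N> by (simp_all add: the_finest_weak_Morse_decomposition_def finest_weak_Morse_decomposition_def)
  then have fin: "finite \<M>" "finite \<N>"
    by (auto simp: weak_Morse_decomposition_def)
  have "equal_up_to_null_sets M \<N> (fibre_image h ` \<M>)"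
    using \<M> \<N> conjugacy.finest_weak_Morse_decomposition_fibre_image
    unfolding the_finest_weak_Morse_decomposition_def by blast
  then have match: "\<And>E. E \<in> \<N> \<Longrightarrow> \<exists>D\<in>\<M>. AE \<omega> in M. E \<omega> = fibre_image h D \<omega>"
    "\<And>D. D \<in> \<M> \<Longrightarrow> \<exists>E\<in>\<N>. AE \<omega> in M. E \<omega> = fibre_image h D \<omega>"
    unfolding equal_up_to_null_sets_def by auto
  have orbit: "AE \<omega> in M. \<forall>t\<in>T. E (\<theta> t \<omega>) = fibre_image h D (\<theta> t \<omega>)"
    if "D \<in> \<M>" "E \<in> \<N>" "AE \<omega> in M. E \<omega> = fibre_image h D \<omega>" for D E
    using that dec(2) conjugacy.weak_Morse_decomposition_fibre_image[OF dec(1)]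
    by (intro \<Psi>.invariant_AE_eq_orbit \<Psi>.Morse_set_invariant[of \<N>] \<Psi>.Morse_set_invariant[of "fibre_image h ` \<M>"]) auto
  \<comment> \<open>Decompositions are finite, so the exceptional sets of the matched pairs have a null union.\<close>
  have "AE \<omega> in M. \<forall>E\<in>\<N>. \<exists>D\<in>\<M>. \<forall>t\<in>T. E (\<theta> t \<omega>) = fibre_image h D (\<theta> t \<omega>)"
  proof (rule AE_finite_allI[OF fin(2)])
    fix E assume "E \<in> \<N>"
    then obtain D where "D \<in> \<M>" "AE \<omega> in M. E \<omega> = fibre_image h D \<omega>" using match(1) by blast
    with orbit[OF this(1) \<open>E \<in> \<N>\<close> this(2)]
    show "AE \<omega> in M. \<exists>D\<in>\<M>. \<forall>t\<in>T. E (\<theta> t \<omega>) = fibre_image h D (\<theta> t \<omega>)" by auto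
  qed
  moreover have "AE \<omega> in M. \<forall>D\<in>\<M>. \<exists>E\<in>\<N>. \<forall>t\<in>T. E (\<theta> t \<omega>) = fibre_image h D (\<theta> t \<omega>)"
  proof (rule AE_finite_allI[OF fin(1)])
    fix D assume "D \<in> \<M>"
    then obtain E where "E \<in> \<N>" "AE \<omega> in M. E \<omega> = fibre_image h D \<omega>" using match(2) by blast
    with orbit[OF \<open>D \<in> \<M>\<close> this]
    show "AE \<omega> in M. \<exists>E\<in>\<N>. \<forall>t\<in>T. E (\<theta> t \<omega>) = fibre_image h D (\<theta> t \<omega>)" by auto
  qed
  ultimately show "AE \<omega> in M. \<Xi>\<^sub>\<Psi> \<omega> = \<Xi>\<^sub>\<Phi> \<omega>"
    using H_tempered[unfolded tempered_def] H_inv_tempered[unfolded tempered_def] AE_space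
  proof eventually_elim
    case (elim \<omega>)
    note \<omega> = elim(5)
    have H_orbit: "invertible (H (\<theta> t \<omega>))" if "t \<in> T" for t
      using H_invertible \<theta>_space[OF that \<omega>] .
    note \<Phi>_orbit = linear_rds_invertible[OF flow_on_axioms rds _ \<theta>_space[OF _ \<omega>]]
      and \<Psi>_orbit = linear_rds_invertible[OF flow_on_axioms \<Psi> _ \<theta>_space[OF _ \<omega>]]
    have sub: "subexponential_distortion T (\<lambda>t. H (\<theta> t \<omega>))"
      using elim(3,4) by (intro tempered_imp_subexponential_distortion T_closed H_continuous[OF \<omega>] H_orbit) auto
    have conj: "?\<Psi> s (\<theta> t \<omega>) *v (H (\<theta> t \<omega>) *v x) = H (\<theta> (s + t) \<omega>) *v (\<Phi> s (\<theta> t \<omega>) *v x)"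
      if "s \<in> T" "t \<in> T" for s t x
      using that \<omega> H_orbit
      by (simp add: conjugate_system_def \<theta>_add matrix_vector_mul_assoc[symmetric] matrix_inv_invertible)
    have spectra: "Morse_spectrum_of T \<theta> \<Phi> (\<lambda>\<omega>'. proj_preimage (D \<omega>')) \<omega> =
        Morse_spectrum_of T \<theta> ?\<Psi> (\<lambda>\<omega>'. proj_preimage (E \<omega>')) \<omega>"
      if DE: "\<forall>t\<in>T. E (\<theta> t \<omega>) = fibre_image h D (\<theta> t \<omega>)" for D E
    proof
      have E: "E (\<theta> t \<omega>) = proj_map (H (\<theta> t \<omega>)) ` D (\<theta> t \<omega>)" if "t \<in> T" for t
        using DE that \<theta>_space[OF that \<omega>] by (simp add: fibre_image_def h_def G_def)
      have D: "D (\<theta> t \<omega>) = proj_map (matrix_inv (H (\<theta> t \<omega>))) ` E (\<theta> t \<omega>)" if "t \<in> T" for t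
        using H_orbit[OF that] by (simp add: E[OF that] image_image proj_map_inverse)
      show "Morse_spectrum_of T \<theta> \<Phi> (\<lambda>\<omega>'. proj_preimage (D \<omega>')) \<omega>
          \<subseteq> Morse_spectrum_of T \<theta> ?\<Psi> (\<lambda>\<omega>'. proj_preimage (E \<omega>')) \<omega>"
        using mem_proj_preimage_image[OF H_orbit]
        by (intro Morse_spectrum_of_conjugate_subset[OF flow_on_axioms \<omega> H_orbit \<Phi>_orbit sub conj]) (auto simp: E)
      show "Morse_spectrum_of T \<theta> ?\<Psi> (\<lambda>\<omega>'. proj_preimage (E \<omega>')) \<omega>
          \<subseteq> Morse_spectrum_of T \<theta> \<Phi> (\<lambda>\<omega>'. proj_preimage (D \<omega>')) \<omega>"
      proof (rule Morse_spectrum_of_conjugate_subset[OF flow_on_axioms \<omega>, where G = "\<lambda>\<omega>'. matrix_inv (H \<omega>')"])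
        show "subexponential_distortion T (\<lambda>t. matrix_inv (H (\<theta> t \<omega>)))"
          by (rule subexponential_distortion_matrix_inv[OF sub H_orbit])
        show "\<Phi> s (\<theta> t \<omega>) *v (matrix_inv (H (\<theta> t \<omega>)) *v x) =
            matrix_inv (H (\<theta> (s + t) \<omega>)) *v (?\<Psi> s (\<theta> t \<omega>) *v x)" if "s \<in> T" "t \<in> T" for s t x
          using conj[OF that, of "matrix_inv (H (\<theta> t \<omega>)) *v x"] that T_add H_orbit
          by (simp add: matrix_inv_invertible)
        show "matrix_inv (H (\<theta> t \<omega>)) *v x \<in> proj_preimage (D (\<theta> t \<omega>))"
          if "t \<in> T" "x \<in> proj_preimage (E (\<theta> t \<omega>))" for t x
          using mem_proj_preimage_image[OF matrix_inv_invertible(5)[OF H_orbit] that(2)] that(1)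
          by (simp add: D)
      qed (simp_all add: H_orbit matrix_inv_invertible \<Psi>_orbit)
    qed
    show "\<Xi>\<^sub>\<Psi> \<omega> = \<Xi>\<^sub>\<Phi> \<omega>"
      unfolding \<Xi>\<^sub>\<Phi>[OF \<omega>] \<Xi>\<^sub>\<Psi>[OF \<omega>]
    proof (intro equalityI UN_least)
      fix E assume "E \<in> \<N>"
      then obtain D where "D \<in> \<M>" "\<forall>t\<in>T. E (\<theta> t \<omega>) = fibre_image h D (\<theta> t \<omega>)" using elim(1) by blast
      then show "Morse_spectrum_of T \<theta> ?\<Psi> (\<lambda>\<omega>'. proj_preimage (E \<omega>')) \<omega>
          \<subseteq> (\<Union>D\<in>\<M>. Morse_spectrum_of T \<theta> \<Phi> (\<lambda>\<omega>'. proj_preimage (D \<omega>')) \<omega>)"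
        using spectra by blast
    next
      fix D assume "D \<in> \<M>"
      then obtain E where "E \<in> \<N>" "\<forall>t\<in>T. E (\<theta> t \<omega>) = fibre_image h D (\<theta> t \<omega>)" using elim(2) by blast
      then show "Morse_spectrum_of T \<theta> \<Phi> (\<lambda>\<omega>'. proj_preimage (D \<omega>')) \<omega>
          \<subseteq> (\<Union>E\<in>\<N>. Morse_spectrum_of T \<theta> ?\<Psi> (\<lambda>\<omega>'. proj_preimage (E \<omega>')) \<omega>)"
        using spectra by blast
    qed
  qed
qed

end
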